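(* \textsc{Egalitarian Stable Roommates} without ties (possibly with incomplete preferences) can be solved in $O(2^{\gamma}\cdot n^2)$ time, where $n$ is the number of agents and $\gamma$ is the egalitarian cost bound.
   Context: Agents $V=\{1,\dots,n\}$ ($n$ even); each agent $i$ has an acceptable set $V_i\subseteq V\setminus\{i\}$ strictly ordered by $\succ_i$ (no ties). Acceptability graph: edge $\{x,y\}$ iff $x\in V_y$, $y\in V_x$. A matching is a set of disjoint edges; $M(x)$ is $x$'s partner or $\bot$. An edge $\{x,y\}\notin M$ blocks $M$ if ($M(x)=\bot$ or $y\succ_x M(x)$) and ($M(y)=\bot$ or $x\succ_y M(y)$); stable means no blocking pair. $\mathrm{rank}_j(i)=|\{x:x\succ_j i\}|$, $\mathrm{rank}_i(\bot)=|V_i|$, egalitarian cost $\gamma(M)=\sum_i\mathrm{rank}_i(M(i))$. \textsc{Egalitarian Stable Roommates}: given a profile and $\gamma$, decide whether a stable matching with egalitarian cost at most $\gamma$ exists. *)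

theory Defs
  imports Main "HOL-Library.Disjoint_Sets"
begin

section \<open>Stable roommates\<close>

text \<open>A profile on the agents \<open>{1..n}\<close> consists of the acceptable sets \<open>V i\<close> and the strict
  preference orders \<open>P i\<close>, where \<open>(x, y) \<in> P i\<close> means that \<open>i\<close> prefers \<open>x\<close> to \<open>y\<close>.
  Acceptability need not be mutual.\<close>

definition agents :: "nat \<Rightarrow> nat set" where
  "agents n = {1..n}"

definition profile :: "nat \<Rightarrow> (nat \<Rightarrow> nat set) \<Rightarrow> (nat \<Rightarrow> nat rel) \<Rightarrow> bool" where
  "profile n V P \<longleftrightarrow>
     (\<forall>i\<in>agents n. V i \<subseteq> agents n - {i} \<and> P i \<subseteq> V i \<times> V i \<and> strict_linear_order_on (V i) (P i))"

definition acceptability_edges :: "nat \<Rightarrow> (nat \<Rightarrow> nat set) \<Rightarrow> nat set set" where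
  "acceptability_edges n V =
     {{x, y} | x y. x \<in> agents n \<and> y \<in> agents n \<and> x \<in> V y \<and> y \<in> V x}"

definition matching :: "nat \<Rightarrow> (nat \<Rightarrow> nat set) \<Rightarrow> nat set set \<Rightarrow> bool" where
  "matching n V M \<longleftrightarrow> M \<subseteq> acceptability_edges n V \<and> disjoint M"

text \<open>\<open>None\<close> stands for being unmatched.\<close>

definition partner :: "nat set set \<Rightarrow> nat \<Rightarrow> nat option" where
  "partner M x = (if \<exists>y. {x, y} \<in> M then Some (THE y. {x, y} \<in> M) else None)"

definition prefers_to_partner :: "(nat \<Rightarrow> nat rel) \<Rightarrow> nat set set \<Rightarrow> nat \<Rightarrow> nat \<Rightarrow> bool" where
  "prefers_to_partner P M x y \<longleftrightarrow>
     (case partner M x of None \<Rightarrow> True | Some z \<Rightarrow> (y, z) \<in> P x)"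

definition blocks ::
  "nat \<Rightarrow> (nat \<Rightarrow> nat set) \<Rightarrow> (nat \<Rightarrow> nat rel) \<Rightarrow> nat \<Rightarrow> nat \<Rightarrow> nat set set \<Rightarrow> bool" where
  "blocks n V P x y M \<longleftrightarrow>
     {x, y} \<in> acceptability_edges n V \<and> {x, y} \<notin> M \<and>
     prefers_to_partner P M x y \<and> prefers_to_partner P M y x"

definition stable_matching ::
  "nat \<Rightarrow> (nat \<Rightarrow> nat set) \<Rightarrow> (nat \<Rightarrow> nat rel) \<Rightarrow> nat set set \<Rightarrow> bool" where
  "stable_matching n V P M \<longleftrightarrow> matching n V M \<and> \<not> (\<exists>x y. blocks n V P x y M)"

definition rank :: "(nat \<Rightarrow> nat rel) \<Rightarrow> nat \<Rightarrow> nat \<Rightarrow> nat" where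
  "rank P j i = card {x. (x, i) \<in> P j}"

definition rank_option :: "(nat \<Rightarrow> nat set) \<Rightarrow> (nat \<Rightarrow> nat rel) \<Rightarrow> nat \<Rightarrow> nat option \<Rightarrow> nat" where
  "rank_option V P i z = (case z of None \<Rightarrow> card (V i) | Some y \<Rightarrow> rank P i y)"

definition egalitarian_cost ::
  "nat \<Rightarrow> (nat \<Rightarrow> nat set) \<Rightarrow> (nat \<Rightarrow> nat rel) \<Rightarrow> nat set set \<Rightarrow> nat" where
  "egalitarian_cost n V P M = (\<Sum>i\<in>agents n. rank_option V P i (partner M i))"

definition egalitarian_stable_roommates ::
  "nat \<Rightarrow> (nat \<Rightarrow> nat set) \<Rightarrow> (nat \<Rightarrow> nat rel) \<Rightarrow> nat \<Rightarrow> bool" where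
  "egalitarian_stable_roommates n V P \<gamma> \<longleftrightarrow>
     (\<exists>M. stable_matching n V P M \<and> egalitarian_cost n V P M \<le> \<gamma>)"

section \<open>Random access machine\<close>

text \<open>A unit-cost word RAM with registers and a memory, both indexed by natural numbers;
  programs are structured. A program text mentions only finitely many registers.
  Arithmetic is limited to addition and truncated subtraction. The parameter \<open>W\<close> of the
  execution relation bounds the numbers that fit into one word: a run that would write a
  larger number gets stuck. As addresses come from registers, it also bounds the memory in use.\<close>

datatype instr =
    LoadConst nat nat  \<comment> \<open>\<open>R[x] := c\<close>\<close>
  | Copy nat nat       \<comment> \<open>\<open>R[x] := R[y]\<close>\<close>
  | AddReg nat nat nat \<comment> \<open>\<open>R[x] := R[y] + R[z]\<close>\<close>
  | SubReg nat nat nat \<comment> \<open>\<open>R[x] := R[y] - R[z]\<close>\<close>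
  | Load nat nat       \<comment> \<open>\<open>R[x] := mem[R[y]]\<close>\<close>
  | Store nat nat      \<comment> \<open>\<open>mem[R[x]] := R[y]\<close>\<close>

datatype test = EqReg nat nat | LessReg nat nat

datatype program =
    Do instr
  | Seq program program
  | Branch test program program
  | Loop test program

type_synonym state = "(nat \<Rightarrow> nat) \<times> (nat \<Rightarrow> nat)"

fun written :: "instr \<Rightarrow> state \<Rightarrow> nat" where
  "written (LoadConst x c) (R, m) = c"
| "written (Copy x y) (R, m) = R y"
| "written (AddReg x y z) (R, m) = R y + R z"
| "written (SubReg x y z) (R, m) = R y - R z"
| "written (Load x y) (R, m) = m (R y)"
| "written (Store x y) (R, m) = R y"

fun update_state :: "instr \<Rightarrow> nat \<Rightarrow> state \<Rightarrow> state" where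
  "update_state (LoadConst x c) v (R, m) = (R(x := v), m)"
| "update_state (Copy x y) v (R, m) = (R(x := v), m)"
| "update_state (AddReg x y z) v (R, m) = (R(x := v), m)"
| "update_state (SubReg x y z) v (R, m) = (R(x := v), m)"
| "update_state (Load x y) v (R, m) = (R(x := v), m)"
| "update_state (Store x y) v (R, m) = (R, m(R x := v))"

fun holds :: "test \<Rightarrow> state \<Rightarrow> bool" where
  "holds (EqReg x y) (R, m) \<longleftrightarrow> R x = R y"
| "holds (LessReg x y) (R, m) \<longleftrightarrow> R x < R y"

text \<open>\<open>exec W p s t s'\<close>: started in \<open>s\<close>, the program \<open>p\<close> halts in \<open>s'\<close> after \<open>t\<close> steps.
  Every instruction and every evaluation of a test is one step.\<close>

inductive exec :: "nat \<Rightarrow> program \<Rightarrow> state \<Rightarrow> nat \<Rightarrow> state \<Rightarrow> bool" for W where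
  Do: "written i s \<le> W \<Longrightarrow> exec W (Do i) s 1 (update_state i (written i s) s)"
| Seq: "\<lbrakk>exec W p s t s'; exec W q s' u s''\<rbrakk> \<Longrightarrow> exec W (Seq p q) s (t + u) s''"
| Branch_True: "\<lbrakk>holds b s; exec W p s t s'\<rbrakk> \<Longrightarrow> exec W (Branch b p q) s (t + 1) s'"
| Branch_False: "\<lbrakk>\<not> holds b s; exec W q s t s'\<rbrakk> \<Longrightarrow> exec W (Branch b p q) s (t + 1) s'"
| Loop_False: "\<not> holds b s \<Longrightarrow> exec W (Loop b p) s 1 s"
| Loop_True: "\<lbrakk>holds b s; exec W p s t s'; exec W (Loop b p) s' u s''\<rbrakk>
    \<Longrightarrow> exec W (Loop b p) s (t + u + 1) s''"

inductive_cases exec_DoE: "exec W (Do i) s t s'"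
inductive_cases exec_SeqE: "exec W (Seq p q) s t s'"
inductive_cases exec_BranchE: "exec W (Branch b p q) s t s'"
inductive_cases exec_LoopE: "exec W (Loop b p) s t s'"

lemma exec_deterministic:
  "exec W p s t s' \<Longrightarrow> exec W p s u s'' \<Longrightarrow> u = t \<and> s'' = s'"
proof (induction arbitrary: u s'' rule: exec.induct)
  case (Do i s)
  then show ?case by (auto elim: exec_DoE)
next
  case (Seq p s t s' q v s2)
  from Seq.prems obtain t1 s1 u1 where "exec W p s t1 s1" "exec W q s1 u1 s''" "u = t1 + u1"
    by (auto elim: exec_SeqE)
  with Seq.IH(1)[of t1 s1] Seq.IH(2)[of u1 s''] show ?case by simp
next
  case (Branch_True b s p t s' q)
  from Branch_True.prems show ?case
    by (rule exec_BranchE) (use Branch_True.IH Branch_True.hyps(1) in auto)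
next
  case (Branch_False b s q t s' p)
  from Branch_False.prems show ?case
    by (rule exec_BranchE) (use Branch_False.IH Branch_False.hyps(1) in auto)
next
  case (Loop_False b s p)
  from Loop_False.prems show ?case by (rule exec_LoopE) (use Loop_False.hyps in auto)
next
  case (Loop_True b s p t s' v s2)
  from Loop_True.prems obtain t1 s1 u1
    where "exec W p s t1 s1" "exec W (Loop b p) s1 u1 s''" "u = t1 + u1 + 1"
    by (rule exec_LoopE) (use Loop_True.hyps(1) in \<open>simp_all\<close>)
  with Loop_True.IH(1)[of t1 s1] Loop_True.IH(2)[of u1 s''] show ?case by simp
qed

text \<open>The input lies at the start of the memory; all other cells and all registers are 0.
  The answer is left in register 0.\<close>

definition initial_state :: "nat list \<Rightarrow> state" where
  "initial_state xs = ((\<lambda>_. 0), (\<lambda>a. if a < length xs then xs ! a else 0))"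

definition decides_within :: "program \<Rightarrow> nat \<Rightarrow> nat list \<Rightarrow> bool \<Rightarrow> nat \<Rightarrow> bool" where
  "decides_within p W xs yes T \<longleftrightarrow>
     (\<exists>t s'. exec W p (initial_state xs) t s' \<and> t \<le> T \<and> fst s' 0 = (if yes then 1 else 0))"

section \<open>Encoding of instances\<close>

text \<open>The acceptable agents of \<open>i\<close>, from the most to the least preferred.\<close>

definition preference_list :: "(nat \<Rightarrow> nat set) \<Rightarrow> (nat \<Rightarrow> nat rel) \<Rightarrow> nat \<Rightarrow> nat list" where
  "preference_list V P i = map (\<lambda>k. THE x. x \<in> V i \<and> rank P i x = k) [0..<card (V i)]"

lemma bij_betw_rank:
  assumes "finite (V i)" "P i \<subseteq> V i \<times> V i" "strict_linear_order_on (V i) (P i)"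
  shows "bij_betw (rank P i) (V i) {..<card (V i)}"
proof -
  from assms(3) have tr: "trans (P i)" and ir: "irrefl (P i)" and tot: "total_on (V i) (P i)"
    by (auto simp: strict_linear_order_on_def)
  have fin: "finite {x. (x, y) \<in> P i}" for y
    by (rule finite_subset[OF _ assms(1)]) (use assms(2) in auto)
  have less: "rank P i x < rank P i y" if "(x, y) \<in> P i" for x y
    unfolding rank_def
    by (rule psubset_card_mono[OF fin]) (use that tr ir in \<open>auto simp: irrefl_def dest: transD\<close>)
  have inj: "inj_on (rank P i) (V i)"
  proof (rule inj_onI)
    fix x y assume xy: "x \<in> V i" "y \<in> V i" and eq: "rank P i x = rank P i y"
    show "x = y"
    proof (rule ccontr)
      assume "x \<noteq> y"
      then have "(x, y) \<in> P i \<or> (y, x) \<in> P i" using tot xy by (auto simp: total_on_def)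
      then show False using less[of x y] less[of y x] eq by linarith
    qed
  qed
  have sub: "rank P i ` V i \<subseteq> {..<card (V i)}"
  proof
    fix k assume "k \<in> rank P i ` V i"
    then obtain y where y: "y \<in> V i" "k = rank P i y" by auto
    have "{x. (x, y) \<in> P i} \<subset> V i" using y(1) ir assms(2) by (auto simp: irrefl_def)
    then show "k \<in> {..<card (V i)}"
      using y psubset_card_mono[OF assms(1)] by (auto simp: rank_def)
  qed
  have "rank P i ` V i = {..<card (V i)}"
    by (rule card_subset_eq[OF _ sub]) (auto simp: card_image[OF inj])
  with inj show ?thesis by (simp add: bij_betw_def)
qed

lemma nth_preference_list_rank:
  assumes "profile n V P" "i \<in> agents n" "x \<in> V i"
  shows "rank P i x < length (preference_list V P i)"
    and "preference_list V P i ! rank P i x = x"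
proof -
  from assms have "V i \<subseteq> {1..n}" "P i \<subseteq> V i \<times> V i" "strict_linear_order_on (V i) (P i)"
    by (auto simp: profile_def agents_def)
  then have bij: "bij_betw (rank P i) (V i) {..<card (V i)}"
    by (intro bij_betw_rank) (auto intro: finite_subset)
  then have lt: "rank P i x < card (V i)" using assms(3) by (auto simp: bij_betw_def)
  then show "rank P i x < length (preference_list V P i)" by (simp add: preference_list_def)
  have "(THE y. y \<in> V i \<and> rank P i y = rank P i x) = x"
    by (rule the_equality) (use assms(3) bij in \<open>auto simp: bij_betw_def inj_on_def\<close>)
  with lt show "preference_list V P i ! rank P i x = x" by (simp add: preference_list_def)
qed

text \<open>An instance is written as \<open>n\<close>, \<open>\<gamma>\<close>, followed by the preference lists of the agents
  \<open>1, \<dots>, n\<close>, each preceded by its length. No ranks are stored, and the lists need not have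
  equal lengths.\<close>

definition encode_instance ::
  "nat \<Rightarrow> (nat \<Rightarrow> nat set) \<Rightarrow> (nat \<Rightarrow> nat rel) \<Rightarrow> nat \<Rightarrow> nat list" where
  "encode_instance n V P \<gamma> =
     n # \<gamma> # concat (map (\<lambda>i. card (V i) # preference_list V P i) [1..<Suc n])"

end

theory Submission
  imports Defs
begin

text \<open>Process the agents in order. An agent \<open>x\<close> that is still unmatched walks down its
  preference list and guesses with one bit per entry \<open>y\<close> whether \<open>{x, y}\<close> belongs to the
  matching; if \<open>x\<close> is the first choice of \<open>y\<close>, stability forces the pair and no bit is spent.
  A guess costs one unit either way: a rejection raises the rank of the partner of \<open>x\<close>, an
  acceptance means that \<open>y\<close> does not get its first choice. Hence every stable matching of
  egalitarian cost at most \<open>\<gamma>\<close> is described by at most \<open>\<gamma>\<close> bits (and, as the cost never exceeds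
  \<open>n\<^sup>2\<close>, by at most \<open>min \<gamma> n\<^sup>2\<close>). The program runs through all bit vectors with a
  binary counter and decodes and checks each of them in time \<open>O(n\<^sup>2)\<close> from a table of ranks.\<close>

section \<open>Total correctness with a time bound\<close>

text \<open>Only completeness needs the charging argument: whatever a bit vector decodes to is
  checked, so it is enough that some short vector reproduces a given stable matching of cost at most
  \<gamma>. The machine shapes the rest. A word holds numbers polynomial in n + \<gamma>, so in
  general the bit vector cannot be a number in a register; it occupies one cell per bit and is
  incremented in place. The cap at n^2 bits allows each increment to scan the whole vector within
  O(n^2). Testing all pairs in O(n^2) requires ranks in constant time, but the input has lists of
  different lengths without ranks, and there is no multiplication; hence the table, whose row
  addresses are stored as well. A number that is too large blocks the run, so each correctness claim
  must also bound every address and sum, including those that arise from vectors describing no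
  matching.\<close>

definition fits :: "nat \<Rightarrow> state \<Rightarrow> bool" where
  "fits W s \<longleftrightarrow> (\<forall>r. fst s r \<le> W) \<and> (\<forall>a. snd s a \<le> W)"

text \<open>Since every written value is at most \<open>W\<close>, \<open>fits W\<close> is invariant; carrying it along
  leaves only constants and additions as instructions that can get stuck.\<close>

definition runs :: "nat \<Rightarrow> program \<Rightarrow> nat \<Rightarrow> (state \<Rightarrow> bool) \<Rightarrow> state \<Rightarrow> bool" where
  "runs W p T Q s \<longleftrightarrow>
     (fits W s \<longrightarrow> (\<exists>t s'. exec W p s t s' \<and> t \<le> T \<and> fits W s' \<and> Q s'))"

text \<open>\<open>duration\<close> and \<open>wp\<close> are meant for loop-free programs only.\<close>

fun duration :: "program \<Rightarrow> nat" where
  "duration (Do i) = 1"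
| "duration (Seq p q) = duration p + duration q"
| "duration (Branch b p q) = max (duration p) (duration q) + 1"
| "duration (Loop b p) = 0"

fun no_overflow :: "nat \<Rightarrow> instr \<Rightarrow> state \<Rightarrow> bool" where
  "no_overflow W (LoadConst x c) s = (c \<le> W)"
| "no_overflow W (AddReg x y z) s = (fst s y + fst s z \<le> W)"
| "no_overflow W _ s = True"

fun wp :: "nat \<Rightarrow> program \<Rightarrow> (state \<Rightarrow> bool) \<Rightarrow> state \<Rightarrow> bool" where
  "wp W (Do i) Q s = (no_overflow W i s \<and> Q (update_state i (written i s) s))"
| "wp W (Seq p q) Q s = wp W p (wp W q Q) s"
| "wp W (Branch b p q) Q s = ((holds b s \<longrightarrow> wp W p Q s) \<and> (\<not> holds b s \<longrightarrow> wp W q Q s))"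
| "wp W (Loop b p) Q s = False"

lemma runs_Do:
  assumes "no_overflow W i s" "Q (update_state i (written i s) s)"
  shows "runs W (Do i) 1 Q s"
  unfolding runs_def
proof
  assume "fits W s"
  obtain R m where s: "s = (R, m)" by (cases s)
  have le: "written i s \<le> W"
    using assms(1) \<open>fits W s\<close> unfolding s by (cases i) (auto simp: fits_def intro: le_trans[OF diff_le_self])
  then have "fits W (update_state i (written i s) s)"
    using \<open>fits W s\<close> unfolding s by (cases i) (auto simp: fits_def)
  with le assms(2) show "\<exists>t s'. exec W (Do i) s t s' \<and> t \<le> 1 \<and> fits W s' \<and> Q s'"
    using exec.Do by blast
qed

lemma runs_Seq:
  assumes "runs W p T (runs W q U Q) s"
  shows "runs W (Seq p q) (T + U) Q s"
  unfolding runs_def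
proof
  assume "fits W s"
  with assms obtain t s' where 1: "exec W p s t s'" "t \<le> T" "fits W s'" "runs W q U Q s'"
    unfolding runs_def[of W p] by auto
  from 1(3,4) obtain u s'' where 2: "exec W q s' u s''" "u \<le> U" "fits W s''" "Q s''"
    unfolding runs_def by auto
  show "\<exists>t s'. exec W (Seq p q) s t s' \<and> t \<le> T + U \<and> fits W s' \<and> Q s'"
    using exec.Seq[OF 1(1) 2(1)] 1(2) 2(2-4) by (intro exI[of _ "t + u"] exI[of _ s'']) auto
qed

lemma runs_mono:
  assumes "runs W p T Q s" "T \<le> U" "\<And>s'. Q s' \<Longrightarrow> Q' s'"
  shows "runs W p U Q' s"
  using assms unfolding runs_def by (meson le_trans)

lemma runs_Branch:
  assumes "holds b s \<Longrightarrow> runs W p T Q s" "\<not> holds b s \<Longrightarrow> runs W q T Q s"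
  shows "runs W (Branch b p q) (T + 1) Q s"
proof (cases "holds b s")
  case True
  then show ?thesis using assms(1) exec.Branch_True[OF True] unfolding runs_def by fastforce
next
  case False
  then show ?thesis using assms(2) exec.Branch_False[OF False] unfolding runs_def by fastforce
qed

lemma runs_wp: "wp W p Q s \<Longrightarrow> runs W p (duration p) Q s"
proof (induction p arbitrary: Q s)
  case (Do i)
  then show ?case by (simp add: runs_Do[simplified])
next
  case (Seq p q)
  then have "runs W p (duration p) (wp W q Q) s" by simp
  from runs_Seq[OF runs_mono[OF this order.refl Seq.IH(2)]] show ?case by simp
next
  case (Branch b p q)
  have "runs W p (max (duration p) (duration q)) Q s" if "holds b s"
    by (rule runs_mono[OF Branch.IH(1)]) (use Branch.prems that in auto)
  moreover have "runs W q (max (duration p) (duration q)) Q s" if "\<not> holds b s"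
    by (rule runs_mono[OF Branch.IH(2)]) (use Branch.prems that in auto)
  ultimately show ?case unfolding duration.simps by (rule runs_Branch)
qed simp

text \<open>For loops whose number of rounds is not known beforehand, such as the walk down a
  preference list, which an acceptance ends early; \<open>f\<close> is the variant. Each round pays
  one step for its test, and the failing test pays the last one.\<close>

lemma runs_Loop:
  assumes "I s" "f s \<le> k"
    and "\<And>s. I s \<Longrightarrow> holds b s \<Longrightarrow> runs W p T (\<lambda>s'. I s' \<and> f s' < f s) s"
  shows "runs W (Loop b p) (k * (T + 1) + 1) (\<lambda>s'. I s' \<and> \<not> holds b s') s"
  using assms(1,2)
proof (induction k arbitrary: s)
  case 0
  show ?case
  proof (cases "holds b s")
    case True
    \<comment> \<open>A further round would have to push the variant below 0, so the state does not
      fit and the claim is vacuous.\<close>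
    with assms(3)[OF 0(1)] 0 have "\<not> fits W s" by (auto simp: runs_def)
    then show ?thesis by (simp add: runs_def)
  next
    case False
    then show ?thesis using exec.Loop_False[OF False] 0 unfolding runs_def by fastforce
  qed
next
  case (Suc k)
  show ?case
  proof (cases "holds b s")
    case True
    show ?thesis unfolding runs_def
    proof
      assume "fits W s"
      with assms(3)[OF Suc.prems(1) True] obtain t s' where
        1: "exec W p s t s'" "t \<le> T" "fits W s'" "I s'" "f s' < f s" unfolding runs_def by auto
      with Suc.IH[of s'] Suc.prems(2) obtain u s'' where
        2: "exec W (Loop b p) s' u s''" "u \<le> k * (T + 1) + 1" "fits W s''" "I s''" "\<not> holds b s''"
        unfolding runs_def by auto
      show "\<exists>t s'. exec W (Loop b p) s t s' \<and> t \<le> Suc k * (T + 1) + 1 \<and> fits W s' \<and> I s' \<and> \<not> holds b s'"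
        using exec.Loop_True[OF True 1(1) 2(1)] 1(2) 2(2-5)
        by (intro exI[of _ "t + u + 1"] exI[of _ s'']) auto
    qed
  next
    case False
    then show ?thesis using exec.Loop_False[OF False] Suc.prems unfolding runs_def by fastforce
  qed
qed

lemma runs_Seq_wp:
  assumes "wp W p (runs W q U Q) s" "duration p + U \<le> T"
  shows "runs W (Seq p q) T Q s"
  by (rule runs_mono[OF runs_Seq[OF runs_wp[OF assms(1)]] assms(2)])

lemma runs_wp_le:
  assumes "wp W p Q s" "duration p \<le> T"
  shows "runs W p T Q s"
  by (rule runs_mono[OF runs_wp[OF assms(1)] assms(2)])

lemma runs_Seq_le:
  assumes "runs W p T1 Q1 s" "\<And>s'. Q1 s' \<Longrightarrow> runs W q T2 Q s'" "T1 + T2 \<le> T"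
  shows "runs W (Seq p q) T Q s"
  by (rule runs_mono[OF runs_Seq[OF runs_mono[OF assms(1) order.refl assms(2)]] assms(3)])

text \<open>For loops with a known number of rounds. The index \<open>d\<close> is a ghost parameter
  of the invariant and need not be stored anywhere, so it may also count through more rounds than a
  word can hold.\<close>

lemma runs_for:
  assumes start: "I 0 s" and T': "k * (T + 1) + 1 \<le> T'"
    and bound: "\<And>d R m. I d (R, m) \<Longrightarrow> d \<le> k \<Longrightarrow> holds b (R, m) = (d < k)"
    and body: "\<And>d R m. I d (R, m) \<Longrightarrow> d < k \<Longrightarrow> runs W p T (I (Suc d)) (R, m)"
  shows "runs W (Loop b p) T' (I k) s"
proof -
  have "runs W (Loop b p) (j * (T + 1) + 1) (I k) s" if "I d s" "d + j = k" for d j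
    using that
  proof (induction j arbitrary: d s)
    case 0
    then have nh: "\<not> holds b s" and "I k s"
      using bound[of d "fst s" "snd s"] by (cases s; simp)+
    then show ?case using exec.Loop_False[OF nh] unfolding runs_def by fastforce
  next
    case (Suc j)
    have d: "d < k" using Suc.prems by simp
    then have h: "holds b s"
      using bound[of d "fst s" "snd s"] Suc.prems by (cases s) simp
    show ?case unfolding runs_def
    proof
      assume "fits W s"
      with body[of d "fst s" "snd s"] Suc.prems d obtain t s' where
        1: "exec W p s t s'" "t \<le> T" "fits W s'" "I (Suc d) s'" unfolding runs_def by auto
      with Suc.IH[of "Suc d" s'] Suc.prems obtain u s'' where
        2: "exec W (Loop b p) s' u s''" "u \<le> j * (T + 1) + 1" "fits W s''" "I k s''"
        unfolding runs_def by auto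
      show "\<exists>t s'. exec W (Loop b p) s t s' \<and> t \<le> Suc j * (T + 1) + 1 \<and> fits W s' \<and> I k s'"
        using exec.Loop_True[OF h 1(1) 2(1)] 1(2) 2(2-4)
        by (intro exI[of _ "t + u + 1"] exI[of _ s'']) auto
    qed
  qed
  from this[of 0 k] start have "runs W (Loop b p) (k * (T + 1) + 1) (I k) s" by simp
  then show ?thesis using T' by (rule runs_mono)
qed

section \<open>Guessing a stable matching bit by bit\<close>

text \<open>The counter \<open>c\<close> is the number of bits read so far, and a true bit rejects.
  Whether \<open>y\<close> is already matched is not looked up: such an entry is passed over by a
  rejecting bit like any other.\<close>

fun propose :: "(nat \<Rightarrow> bool) \<Rightarrow> (nat \<Rightarrow> nat \<Rightarrow> nat) \<Rightarrow> nat \<Rightarrow> nat list \<Rightarrow> (nat \<Rightarrow> nat) \<times> nat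
    \<Rightarrow> (nat \<Rightarrow> nat) \<times> nat" where
  "propose \<beta> rk x [] s = s"
| "propose \<beta> rk x (y # ys) (q, c) =
     (if rk y x = 1 then (q(x := y, y := x), c)
      else if \<not> \<beta> c then (q(x := y, y := x), Suc c)
      else propose \<beta> rk x ys (q, Suc c))"

text \<open>In the locale, a matching is a function \<open>q\<close> with \<open>q x = 0\<close> for unmatched \<open>x\<close>, and ranks
  are shifted by one such that \<open>rk x y = 0\<close> encodes that \<open>y\<close> is not acceptable for \<open>x\<close>.\<close>

locale roommates =
  fixes n :: nat and L :: "nat \<Rightarrow> nat list"
  assumes n_ge2: "2 \<le> n"
    and L_distinct: "i \<in> {1..n} \<Longrightarrow> distinct (L i)"
    and L_subset: "i \<in> {1..n} \<Longrightarrow> set (L i) \<subseteq> {1..n} - {i}"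
begin

definition rk :: "nat \<Rightarrow> nat \<Rightarrow> nat" where
  "rk i y = (if y \<in> set (L i) then Suc (length (takeWhile (\<lambda>z. z \<noteq> y) (L i))) else 0)"

text \<open>The summand of the egalitarian cost. For an unacceptable partner truncated subtraction
  makes it 0, the value that \<open>validate\<close> stores as well.\<close>

definition dis :: "(nat \<Rightarrow> nat) \<Rightarrow> nat \<Rightarrow> nat" where
  "dis q x = (if q x = 0 then length (L x) else rk x (q x) - 1)"

definition valid_at :: "(nat \<Rightarrow> nat) \<Rightarrow> nat \<Rightarrow> bool" where
  "valid_at q x \<longleftrightarrow> (q x \<noteq> 0 \<longrightarrow> q (q x) = x \<and> rk x (q x) \<noteq> 0)"

text \<open>Because of the shift, \<open>rk x y \<le> dis q x\<close> is strict preference over the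
  partner. It holds for every acceptable \<open>y\<close> if \<open>x\<close> is unmatched, and
  fails for the partner itself, so matched pairs need no separate exclusion.\<close>

definition blocking :: "(nat \<Rightarrow> nat) \<Rightarrow> nat \<Rightarrow> nat \<Rightarrow> bool" where
  "blocking q x y \<longleftrightarrow> rk x y \<noteq> 0 \<and> rk x y \<le> dis q x \<and> rk y x \<noteq> 0 \<and> rk y x \<le> dis q y"

definition good :: "nat \<Rightarrow> (nat \<Rightarrow> nat) \<Rightarrow> bool" where
  "good \<gamma> q \<longleftrightarrow> (\<forall>x\<in>{1..n}. valid_at q x) \<and> sum (dis q) {1..n} \<le> \<gamma> \<and>
     (\<forall>x\<in>{1..n}. \<forall>y\<in>{1..n}. \<not> blocking q x y)"

fun guess :: "(nat \<Rightarrow> bool) \<Rightarrow> nat \<Rightarrow> (nat \<Rightarrow> nat) \<times> nat" where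
  "guess \<beta> 0 = (\<lambda>_. 0, 0)"
| "guess \<beta> (Suc x) =
     (if fst (guess \<beta> x) (Suc x) = 0 then propose \<beta> rk (Suc x) (L (Suc x)) (guess \<beta> x)
      else guess \<beta> x)"

lemma L_nth: "i \<in> {1..n} \<Longrightarrow> j < length (L i) \<Longrightarrow> L i ! j \<in> {1..n} \<and> L i ! j \<noteq> i"
  using subsetD[OF L_subset[of i] nth_mem[of j "L i"]] by auto

lemma length_L: "i \<in> {1..n} \<Longrightarrow> length (L i) < n"
proof -
  assume i: "i \<in> {1..n}"
  have "length (L i) = card (set (L i))" using L_distinct[OF i] by (simp add: distinct_card)
  also have "\<dots> \<le> card ({1..n} - {i})" using L_subset[OF i] by (intro card_mono) auto
  also have "\<dots> < n" using i by simp
  finally show ?thesis .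
qed

lemma rk_nth:
  assumes "i \<in> {1..n}" "j < length (L i)"
  shows "rk i (L i ! j) = Suc j"
proof -
  let ?k = "length (takeWhile (\<lambda>z. z \<noteq> L i ! j) (L i))"
  have "?k < length (L i)" using assms(2)
    by (metis (mono_tags) le_neq_implies_less length_takeWhile_le nth_mem set_takeWhileD
        takeWhile_eq_take take_all_iff order_refl)
  moreover from this have "L i ! ?k = L i ! j" using nth_length_takeWhile by blast
  ultimately have "?k = j" using L_distinct[OF assms(1)] assms(2) nth_eq_iff_index_eq by blast
  then show ?thesis using assms(2) by (simp add: rk_def)
qed

lemma rk_eq_0: "rk i y = 0 \<longleftrightarrow> y \<notin> set (L i)"
  by (simp add: rk_def)

lemma rk_pos:
  assumes "i \<in> {1..n}" "rk i y \<noteq> 0"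
  shows "y \<in> {1..n}" "y \<noteq> i" "rk i y \<le> length (L i)" "L i ! (rk i y - 1) = y"
proof -
  from assms(2) obtain j where "j < length (L i)" "L i ! j = y" by (auto simp: rk_eq_0 in_set_conv_nth)
  then show "y \<in> {1..n}" "y \<noteq> i" "rk i y \<le> length (L i)" "L i ! (rk i y - 1) = y"
    using rk_nth[OF assms(1), of j] L_nth[OF assms(1), of j] by auto
qed

lemma rk_le: "i \<in> {1..n} \<Longrightarrow> rk i y \<le> n"
  using rk_pos(3)[of i y] length_L[of i] by (cases "rk i y = 0") auto

lemma dis_le: "x \<in> {1..n} \<Longrightarrow> dis q x \<le> n"
  using rk_le[of x "q x"] length_L[of x]
  by (auto simp: dis_def intro: le_trans[OF diff_le_self])

text \<open>The charging invariant. An agent is settled once it has been processed or matched, and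
  the bits read so far are paid by the final costs of the settled agents. Quantifying over all
  \<open>\<beta>\<close> that start with \<open>bs\<close> leaves the later bits free for the next
  agent.\<close>

definition follows :: "(nat \<Rightarrow> nat) \<Rightarrow> nat \<Rightarrow> bool list \<Rightarrow> (nat \<Rightarrow> nat) \<Rightarrow> bool" where
  "follows q k bs p \<longleftrightarrow>
     (\<forall>\<beta>. (\<forall>i<length bs. \<beta> i = bs ! i) \<longrightarrow> guess \<beta> k = (p, length bs)) \<and>
     (\<forall>x. p x \<noteq> 0 \<longrightarrow> x \<in> {1..n} \<and> p x = q x \<and> p (p x) = x) \<and>
     (\<forall>x\<in>{1..k}. p x = q x) \<and> length bs \<le> sum (dis q) ({1..k} \<union> {x. p x \<noteq> 0})"

lemma followsI:
  assumes "\<And>\<beta>. \<forall>i<length bs. \<beta> i = bs ! i \<Longrightarrow> guess \<beta> k = (p, length bs)"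
    and "\<And>x. p x \<noteq> 0 \<Longrightarrow> x \<in> {1..n} \<and> p x = q x \<and> p (p x) = x"
    and "\<And>x. x \<in> {1..k} \<Longrightarrow> p x = q x"
    and "{1..k} \<union> {x. p x \<noteq> 0} = D" "length bs \<le> sum (dis q) D"
  shows "follows q k bs p"
  unfolding follows_def using assms by blast

text \<open>A good \<open>q\<close> is arbitrary outside the agents, whereas a decoded matching is 0
  there. Although \<open>valid_at\<close> evaluates \<open>q\<close> at \<open>q x\<close>, an
  acceptable \<open>q x\<close> is again an agent, and an unacceptable one settles the matter by its
  rank.\<close>

lemma good_cong:
  assumes "\<And>x. x \<in> {1..n} \<Longrightarrow> q x = q' x"
  shows "good \<gamma> q = good \<gamma> q'"
proof -
  have d: "dis q x = dis q' x" if "x \<in> {1..n}" for x using assms[OF that] by (simp add: dis_def)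
  have v: "valid_at q x = valid_at q' x" if "x \<in> {1..n}" for x
  proof (cases "q x = 0 \<or> rk x (q x) = 0")
    case False
    then have "q x \<in> {1..n}" using rk_pos(1)[OF that] by blast
    then show ?thesis using assms that by (simp add: valid_at_def)
  qed (use assms[OF that] in \<open>auto simp: valid_at_def\<close>)
  have "sum (dis q) {1..n} = sum (dis q') {1..n}" using d by (rule sum.cong[OF refl])
  then show ?thesis using d v by (simp add: good_def blocking_def)
qed

lemma propose_skip:
  assumes "d \<le> length ys" "\<And>j. j < d \<Longrightarrow> rk (ys ! j) x \<noteq> 1" "\<And>j. j < d \<Longrightarrow> \<beta> (c + j)"
  shows "propose \<beta> rk x ys (q, c) = propose \<beta> rk x (drop d ys) (q, c + d)"
  using assms
proof (induction d arbitrary: ys c)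
  case (Suc d)
  then obtain y ys' where ys: "ys = y # ys'" by (cases ys) auto
  have "propose \<beta> rk x ys' (q, Suc c) = propose \<beta> rk x (drop d ys') (q, Suc c + d)"
  proof (rule Suc.IH)
    show "rk (ys' ! j) x \<noteq> 1" if "j < d" for j using Suc.prems(2)[of "Suc j"] that ys by simp
    show "\<beta> (Suc c + j)" if "j < d" for j using Suc.prems(3)[of "Suc j"] that by simp
  qed (use Suc.prems ys in auto)
  then show ?case using Suc.prems(2)[of 0] Suc.prems(3)[of 0] ys by simp
qed simp

text \<open>A rejected proposal is charged to the proposer, whose rank of its partner grows, and an
  accepted one to the recipient, for whom the proposer is not the first choice. If the
  proposer is its first choice, no bit is read: not matching them would create a blocking pair.\<close>

lemma guess_follows:
  assumes good: "good \<gamma> q" and "k \<le> n"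
  shows "\<exists>bs p. follows q k bs p"
  using assms(2)
proof (induction k)
  case 0
  have "follows q 0 [] (\<lambda>_. 0)" by (simp add: follows_def)
  then show ?case by blast
next
  case (Suc k)
  define x where "x = Suc k"
  have x: "x \<in> {1..n}" using Suc.prems by (simp add: x_def)
  have ivl: "{1..Suc k} = insert x {1..k}" by (auto simp: x_def)
  have valid: "valid_at q z" if "z \<in> {1..n}" for z using good that by (auto simp: good_def)
  from Suc.IH Suc.prems obtain bs p where f: "follows q k bs p" by (meson Suc_leD)
  have bs: "guess \<beta> k = (p, length bs)" if "\<forall>i<length bs. \<beta> i = bs ! i" for \<beta>
    using f that unfolding follows_def by blast
  have p: "p z \<noteq> 0 \<Longrightarrow> z \<in> {1..n} \<and> p z = q z \<and> p (p z) = z" "z \<in> {1..k} \<Longrightarrow> p z = q z" for z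
    using f unfolding follows_def by blast+
  define D where "D = {1..k} \<union> {z. p z \<noteq> 0}"
  have "{z. p z \<noteq> 0} \<subseteq> {1..n}" using p(1) by blast
  then have D: "finite D" "length bs \<le> sum (dis q) D"
    using f unfolding D_def follows_def by (blast intro: finite_subset)+
  show ?case
  proof (cases "p x = 0")
    case False
    have "{1..Suc k} \<union> {z. p z \<noteq> 0} = D" unfolding ivl D_def using False by blast
    moreover have "guess \<beta> (Suc k) = (p, length bs)" if "\<forall>i<length bs. \<beta> i = bs ! i" for \<beta>
      using bs[OF that] False by (simp add: x_def)
    moreover have "p z = q z" if "z \<in> {1..Suc k}" for z
      using that p(1)[OF False] p(2)[of z] unfolding ivl by blast
    ultimately have "follows q (Suc k) bs p" using p(1) D(2) by (intro followsI)
    then show ?thesis by blast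
  next
    case True
    \<comment> \<open>The number of entries to reject: the whole list if \<open>x\<close> stays
      unmatched, otherwise the entries before its partner. As \<open>x\<close> is not yet settled,
      its cost \<open>d\<close> is still unspent and pays for exactly these bits.\<close>
    define d where "d = dis q x"
    have xD: "x \<notin> D" using True by (auto simp: D_def x_def)
    have d_le: "d \<le> length (L x)"
      using rk_pos(3)[OF x, of "q x"] by (cases "rk x (q x) = 0") (auto simp: d_def dis_def)
    have not_first: "rk (L x ! j) x \<noteq> 1" if "j < d" for j
    proof
      let ?y = "L x ! j"
      assume first: "rk ?y x = 1"
      have j: "j < length (L x)" using that d_le by simp
      have y: "?y \<in> {1..n}" using L_nth[OF x j] by simp
      \<comment> \<open>Cost 0 would mean that \<open>?y\<close> has its first choice, which is
        \<open>x\<close>; then \<open>?y\<close> would be the partner of \<open>x\<close> and stand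
        at index \<open>d\<close>, not before it.\<close>
      have "dis q ?y \<noteq> 0"
      proof
        assume 0: "dis q ?y = 0"
        have "length (L ?y) \<noteq> 0" using rk_pos(3)[OF y, of x] first by auto
        then have "q ?y \<noteq> 0" using 0 by (auto simp: dis_def split: if_splits)
        then have "rk ?y (q ?y) = 1" "q (q ?y) = ?y"
          using valid[OF y] 0 by (auto simp: valid_at_def dis_def)
        moreover from this have "q ?y = x" using rk_pos(4)[OF y, of x] rk_pos(4)[OF y, of "q ?y"] first by simp
        ultimately have "q x = ?y" by simp
        then have "d = j" using rk_nth[OF x j] y by (auto simp: d_def dis_def)
        then show False using that by simp
      qed
      then have "blocking q x ?y"
        using first rk_nth[OF x j] that unfolding blocking_def d_def by linarith
      then show False using good x y unfolding good_def by blast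
    qed
    have skip: "guess \<beta> (Suc k) = propose \<beta> rk x (drop d (L x)) (p, length bs + d)"
      if "\<forall>i<length (bs @ replicate d True). \<beta> i = (bs @ replicate d True) ! i" for \<beta>
    proof -
      have "guess \<beta> k = (p, length bs)"
      proof (rule bs, intro allI impI)
        fix i assume "i < length bs"
        then show "\<beta> i = bs ! i" using that[rule_format, of i] by (simp add: nth_append)
      qed
      then have "guess \<beta> (Suc k) = propose \<beta> rk x (L x) (p, length bs)" using True by (simp add: x_def)
      also have "\<dots> = propose \<beta> rk x (drop d (L x)) (p, length bs + d)"
      proof (rule propose_skip[OF d_le not_first])
        fix j assume "j < d"
        then show "\<beta> (length bs + j)" using that[rule_format, of "length bs + j"] by (simp add: nth_append)
      qed
      finally show ?thesis .
    qed
    show ?thesis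
    proof (cases "q x = 0")
      case unmatched: True
      then have "drop d (L x) = []" by (simp add: d_def dis_def)
      then have "guess \<beta> (Suc k) = (p, length (bs @ replicate d True))"
        if "\<forall>i<length (bs @ replicate d True). \<beta> i = (bs @ replicate d True) ! i" for \<beta>
        using skip[OF that] by simp
      moreover have "p z = q z" if "z \<in> {1..Suc k}" for z
        using that p(2)[of z] True unmatched unfolding ivl by auto
      moreover have "{1..Suc k} \<union> {z. p z \<noteq> 0} = insert x D" unfolding ivl D_def by auto
      moreover have "length (bs @ replicate d True) \<le> sum (dis q) (insert x D)"
        using D xD by (simp add: d_def)
      ultimately have "follows q (Suc k) (bs @ replicate d True) p"
        using p(1) by (intro followsI)
      then show ?thesis by blast
    next
      case False
      define y where "y = q x"
      have xy: "q y = x" "rk x y \<noteq> 0" using valid[OF x] False by (auto simp: valid_at_def y_def)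
      have y: "y \<in> {1..n}" "y \<noteq> x" using rk_pos(1,2)[OF x xy(2)] by auto
      have yx: "rk y x \<noteq> 0" using valid[OF y(1)] xy(1) x by (simp add: valid_at_def)
      have py: "p y = 0"
      proof (rule ccontr)
        assume "p y \<noteq> 0"
        from p(1)[OF this] have "p (q y) = y" by metis
        then show False using xy(1) True y(1) by simp
      qed
      \<comment> \<open>The partner is not settled either: an agent up to \<open>k\<close> would
        already be matched to \<open>x\<close> in \<open>p\<close>. Hence its cost
        \<open>rk y x - 1\<close> is also unspent.\<close>
      have yD: "y \<notin> D" using p(2)[of y] py xy(1) x by (auto simp: D_def)
      have d: "d = rk x y - 1" using False by (simp add: d_def dis_def y_def)
      have dropd: "drop d (L x) = y # drop (Suc d) (L x)"
        using Cons_nth_drop_Suc[of d "L x"] rk_pos(3,4)[OF x xy(2)] xy(2) d by simp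
      define p' where "p' = p(x := y, y := x)"
      have p': "p' z = q z" if "z \<in> {1..Suc k}" for z
        using that[unfolded ivl] p(2)[of z] y xy by (cases "z = x") (auto simp: p'_def y_def)
      have p'': "z \<in> {1..n} \<and> p' z = q z \<and> p' (p' z) = z" if "p' z \<noteq> 0" for z
      proof (cases "z = x \<or> z = y")
        case True
        then show ?thesis using x y xy by (auto simp: p'_def y_def)
      next
        case other: False
        then have "p z \<noteq> 0" using that by (simp add: p'_def)
        then have "z \<in> {1..n} \<and> p z = q z \<and> p (p z) = z" by (rule p(1))
        moreover have "p z \<noteq> x" "p z \<noteq> y" using calculation True py other \<open>p z \<noteq> 0\<close> x y by auto
        ultimately show ?thesis using other unfolding p'_def by (metis fun_upd_other)
      qed
      have D': "{1..Suc k} \<union> {z. p' z \<noteq> 0} = insert x (insert y D)"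
        using x y unfolding ivl D_def p'_def by auto
      have sumD': "sum (dis q) (insert x (insert y D)) = d + (rk y x - 1) + sum (dis q) D"
        using D xD yD y x xy(1) by (simp add: d_def dis_def[of q y])
      show ?thesis
      proof (cases "rk y x = 1")
        case True
        have "guess \<beta> (Suc k) = (p', length (bs @ replicate d True))"
          if "\<forall>i<length (bs @ replicate d True). \<beta> i = (bs @ replicate d True) ! i" for \<beta>
          using skip[OF that] dropd True by (simp add: p'_def)
        moreover have "length (bs @ replicate d True) \<le> sum (dis q) (insert x (insert y D))"
          using sumD' D(2) by simp
        ultimately have "follows q (Suc k) (bs @ replicate d True) p'"
          using p' p'' D' by (intro followsI)
        then show ?thesis by blast
      next
        case notfirst: False
        let ?bs = "bs @ replicate d True @ [False]"
        have "guess \<beta> (Suc k) = (p', length ?bs)" if *: "\<forall>i<length ?bs. \<beta> i = ?bs ! i" for \<beta>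
        proof -
          have "\<forall>i<length (bs @ replicate d True). \<beta> i = (bs @ replicate d True) ! i"
          proof (intro allI impI)
            fix i assume "i < length (bs @ replicate d True)"
            then show "\<beta> i = (bs @ replicate d True) ! i" using *[rule_format, of i] by (auto simp: nth_append)
          qed
          moreover have "\<not> \<beta> (length bs + d)" using *[rule_format, of "length bs + d"] by (simp add: nth_append)
          ultimately show ?thesis using skip[of \<beta>] dropd notfirst by (simp add: p'_def)
        qed
        \<comment> \<open>The accepting bit is paid by \<open>rk y x - 1\<close>, which is positive
          since \<open>x\<close> is acceptable to \<open>y\<close> but not its first choice.\<close>
        moreover have "length ?bs \<le> sum (dis q) (insert x (insert y D))"
          using sumD' D(2) yx notfirst by simp
        ultimately have "follows q (Suc k) ?bs p'"
          using p' p'' D' by (intro followsI)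
        then show ?thesis by blast
      qed
    qed
  qed
qed

lemma exists_guess:
  assumes "good \<gamma> q"
  shows "\<exists>v. (v::nat) < 2 ^ min \<gamma> (n * n) \<and> good \<gamma> (fst (guess (bit v) n))"
proof -
  from guess_follows[OF assms order.refl] obtain bs p where f: "follows q n bs p" by blast
  have p: "p x \<noteq> 0 \<Longrightarrow> x \<in> {1..n}" "x \<in> {1..n} \<Longrightarrow> p x = q x" for x
    using f unfolding follows_def by blast+
  \<comment> \<open>The bits are read with the least significant one first. Whatever follows them in
    \<open>v\<close> is irrelevant, since \<open>follows\<close> admits every continuation.\<close>
  define v :: nat where "v = horner_sum of_bool 2 bs"
  have "\<forall>i<length bs. bit v i = bs ! i" by (simp add: v_def bit_horner_sum_bit_iff)
  then have guess: "guess (bit v) n = (p, length bs)"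
    using f unfolding follows_def by blast
  have "{1..n} \<union> {x. p x \<noteq> 0} = {1..n}" using p(1) by auto
  then have len: "length bs \<le> sum (dis q) {1..n}" using f unfolding follows_def by metis
  moreover have "sum (dis q) {1..n} \<le> (\<Sum>x\<in>{1..n}. n)" by (intro sum_mono dis_le)
  ultimately have "length bs \<le> min \<gamma> (n * n)" using assms by (simp add: good_def)
  moreover have "v < 2 ^ length bs" unfolding v_def by (rule horner_sum_of_bool_2_less)
  ultimately have "v < 2 ^ min \<gamma> (n * n)"
    by (meson less_le_trans one_le_numeral power_increasing)
  moreover have "good \<gamma> p" using good_cong[of p q] p(2) assms by simp
  ultimately show ?thesis using guess by auto
qed

end

section \<open>The program\<close>

notation Seq (infixr ";;" 60)

abbreviation (input) "const x c \<equiv> Do (LoadConst x c)"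
abbreviation (input) "copy x y \<equiv> Do (Copy x y)"
abbreviation (input) "add x y z \<equiv> Do (AddReg x y z)"
abbreviation (input) "sub x y z \<equiv> Do (SubReg x y z)"
abbreviation (input) "load x y \<equiv> Do (Load x y)"
abbreviation (input) "store x y \<equiv> Do (Store x y)"

text \<open>Register \<open>Qb\<close> holds the base address of the guessed matching, \<open>Db\<close> that of the ranks of
  the partners, \<open>Rb\<close> that of the addresses of the rows of the rank table, and the bit vector
  lies between \<open>Kb + 1\<close> and \<open>Eb\<close>. Names denote register numbers, \<open>One\<close> and \<open>Zero\<close> hold these
  constants, and \<open>Ans\<close> is the output register.\<close>

abbreviation (input) "Ans \<equiv> 0 :: nat"
abbreviation (input) "One \<equiv> 2 :: nat"
abbreviation (input) "Zero \<equiv> 3 :: nat"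
abbreviation (input) "N \<equiv> 4 :: nat"
abbreviation (input) "G \<equiv> 5 :: nat"
abbreviation (input) "Sq \<equiv> 6 :: nat"
abbreviation (input) "Qb \<equiv> 7 :: nat"
abbreviation (input) "Db \<equiv> 8 :: nat"
abbreviation (input) "Rb \<equiv> 9 :: nat"
abbreviation (input) "Kb \<equiv> 10 :: nat"
abbreviation (input) "Eb \<equiv> 11 :: nat"
abbreviation (input) "X \<equiv> 12 :: nat"
abbreviation (input) "Y \<equiv> 13 :: nat"
abbreviation (input) "J \<equiv> 14 :: nat"
abbreviation (input) "E \<equiv> 15 :: nat"
abbreviation (input) "Ptr \<equiv> 16 :: nat"
abbreviation (input) "T \<equiv> 17 :: nat"
abbreviation (input) "U \<equiv> 18 :: nat"
abbreviation (input) "Bp \<equiv> 19 :: nat"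
abbreviation (input) "Bad \<equiv> 20 :: nat"
abbreviation (input) "Cost \<equiv> 21 :: nat"
abbreviation (input) "Carry \<equiv> 22 :: nat"
abbreviation (input) "Row \<equiv> 23 :: nat"

abbreviation (input) "skip \<equiv> copy U U"

definition reset :: program where
  "reset = copy X Zero ;; Loop (LessReg X N) (add X X One ;; add T Qb X ;; store T Zero)"

text \<open>A forced pair is treated like an accepting bit: \<open>U\<close> is 0 in both cases.
  Acceptance moves \<open>J\<close> to the end \<open>E\<close> of the list, which ends the
  surrounding loop.\<close>

definition proposal :: program where
  "proposal =
     add J J One ;; load Y J ;; add T Rb Y ;; load T T ;; add T T X ;; load U T ;;
     Branch (EqReg U One) (copy U Zero) (add Bp Bp One ;; load U Bp) ;;
     Branch (EqReg U Zero)
       (add T Qb X ;; store T Y ;; add T Qb Y ;; store T X ;; copy J E)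
       skip"

text \<open>\<open>J\<close> starts at the cell with the list length because \<open>proposal\<close>
  increments before it reads. For an agent that is already matched it starts at \<open>E\<close>, so
  no entry is visited.\<close>

definition next_list :: program where
  "next_list =
     add X X One ;; load U Ptr ;; add E Ptr U ;; copy J Ptr ;; add Ptr E One ;;
     add T Qb X ;; load U T ;; Branch (EqReg U Zero) skip (copy J E)"

text \<open>Bit vectors that describe no matching may overwrite earlier pairs or run past \<open>Eb\<close>; this
  is harmless, as the outcome is validated afterwards.\<close>

definition simulate :: program where
  "simulate =
     (copy X Zero ;; add Ptr One One ;; copy Bp Kb) ;;
     Loop (LessReg X N) (next_list ;; Loop (LessReg J E) proposal)"

text \<open>For an unmatched agent \<open>U\<close> still holds the list length, which is its cost;
  otherwise \<open>U\<close> is overwritten by the shifted rank of the partner and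
  decremented.\<close>

definition validate :: program where
  "validate =
     (copy X Zero ;; add Ptr One One ;; copy Bad Zero ;; copy Cost Zero) ;;
     Loop (LessReg X N)
       (add X X One ;; load U Ptr ;; add Ptr Ptr U ;; add Ptr Ptr One ;;
        add T Qb X ;; load Y T ;;
        Branch (EqReg Y Zero) skip
          (add T Qb Y ;; load T T ;;
           Branch (EqReg T X) skip (copy Bad One) ;;
           add T Rb X ;; load T T ;; add T T Y ;; load U T ;;
           Branch (EqReg U Zero) (copy Bad One) (sub U U One)) ;;
        add T Db X ;; store T U ;; add Cost Cost U) ;;
     Branch (LessReg G Cost) (copy Bad One) skip"

text \<open>Here \<open>E\<close> is reused for the cost of \<open>X\<close>, and \<open>Row\<close>
  is the address of the row of \<open>X\<close>.\<close>

definition check_pair :: program where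
  "check_pair =
     add Y Y One ;; add T Row Y ;; load U T ;;
     Branch (EqReg U Zero) skip (Branch (LessReg E U) skip
       (add T Rb Y ;; load T T ;; add T T X ;; load U T ;;
        Branch (EqReg U Zero) skip
          (add T Db Y ;; load T T ;; Branch (LessReg T U) skip (copy Bad One))))"

definition check_pairs :: program where
  "check_pairs =
     copy X Zero ;;
     Loop (LessReg X N)
       ((add X X One ;; copy Y Zero ;; add T Rb X ;; load Row T ;; add T Db X ;; load E T) ;;
        Loop (LessReg Y N) check_pair)"

text \<open>A ripple-carry increment. A carry that survives the last bit means that all vectors have
  been tried; it is the exit condition of \<open>solver\<close>.\<close>

definition increment :: program where
  "increment =
     (copy Carry One ;; copy J Kb) ;;
     Loop (LessReg J Eb)
       (add J J One ;;
        Branch (EqReg Carry One)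
          (load U J ;; Branch (EqReg U One) (store J Zero) (store J One ;; copy Carry Zero))
          skip)"

definition attempt :: program where
  "attempt = reset ;; simulate ;; validate ;; check_pairs ;;
     (Branch (EqReg Bad Zero) (copy Ans One) skip) ;; increment"

text \<open>The constants 0 and 1 double as the addresses of n and \<gamma>. The loop replaces the
  missing multiplication and relies on registers that start at 0.\<close>

definition square :: program where
  "square = (const One 1 ;; load N Zero ;; load G One) ;;
     Loop (LessReg X N) (add X X One ;; add Sq Sq N)"

definition layout :: program where
  "layout = add Qb Sq One ;; add Db Qb N ;; add Rb Db N ;; copy Row Rb ;;
     copy X Zero ;; add Ptr One One"

text \<open>\<open>Ptr\<close> stays at the cell with the list length, so \<open>J - Ptr\<close> is
  the position counted from 1, that is, the shifted rank.\<close>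

definition fill_row :: program where
  "fill_row =
     (add X X One ;; add Row Row N ;; add T Rb X ;; store T Row ;;
      load U Ptr ;; add E Ptr U ;; copy J Ptr) ;;
     Loop (LessReg J E)
       (add J J One ;; load Y J ;; add T Row Y ;; sub U J Ptr ;; store T U) ;;
     add Ptr E One"

text \<open>The vector can be placed only now, behind the last row, whose address is left in
  \<open>Row\<close>. Memory there is still 0, so the enumeration starts with the zero
  vector.\<close>

definition bound_bits :: program where
  "bound_bits = add Kb Row N ;; Branch (LessReg Sq G) (add Eb Kb Sq) (add Eb Kb G) ;; copy Carry Zero"

definition solver :: program where
  "solver = square ;; layout ;; Loop (LessReg X N) fill_row ;; bound_bits ;;
     Loop (EqReg Carry Zero) attempt"

section \<open>Correctness of the program\<close>

text \<open>All cells in use lie below address \<open>8 * (n * n)\<close>; the larger factor 16 is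
  what \<open>n ^ 6\<close> provides over \<open>n ^ 2\<close> for \<open>n \<ge> 2\<close>.\<close>

locale roommates_ram = roommates +
  fixes \<gamma> W :: nat
  assumes W_square: "16 * (n * n) \<le> W" and W_gamma: "\<gamma> \<le> W"
begin

text \<open>The address of the length cell of agent \<open>Suc i\<close>; the summand 2 skips n and
  \<gamma>.\<close>

definition pos :: "nat \<Rightarrow> nat" where
  "pos i = 2 + (\<Sum>k<i. Suc (length (L (Suc k))))"

text \<open>The input ends at this address at the latest. Agents are numbered from 1, so the base
  cell itself is not part of the array.\<close>

definition qB :: nat where "qB = n * n + 1"
definition dB :: nat where "dB = qB + n"
definition rB :: nat where "rB = dB + n"
text \<open>The place of a row with index 0 is taken by the array of row addresses, so the table
  follows it without a gap.\<close>

definition row :: "nat \<Rightarrow> nat" where "row i = rB + i * n"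
definition kB :: nat where "kB = row n + n"
definition eB :: nat where "eB = kB + min \<gamma> (n * n)"

definition env :: "(nat \<Rightarrow> nat) \<Rightarrow> bool" where
  "env R \<longleftrightarrow> R One = 1 \<and> R Zero = 0 \<and> R N = n \<and> R G = \<gamma> \<and> R Sq = n * n \<and>
     R Qb = qB \<and> R Db = dB \<and> R Rb = rB \<and> R Kb = kB \<and> R Eb = eB"

definition lists_stored :: "(nat \<Rightarrow> nat) \<Rightarrow> bool" where
  "lists_stored m \<longleftrightarrow> (\<forall>i<n. m (pos i) = length (L (Suc i)) \<and>
     (\<forall>j<length (L (Suc i)). m (pos i + Suc j) = L (Suc i) ! j))"

definition ranks_stored :: "(nat \<Rightarrow> nat) \<Rightarrow> bool" where
  "ranks_stored m \<longleftrightarrow> (\<forall>i\<in>{1..n}. m (rB + i) = row i \<and> (\<forall>y\<in>{1..n}. m (row i + y) = rk i y))"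

definition tables :: "(nat \<Rightarrow> nat) \<Rightarrow> bool" where
  "tables m \<longleftrightarrow> lists_stored m \<and> ranks_stored m"

section \<open>Bounds on addresses, and writes that preserve the tables\<close>

lemma pos_0: "pos 0 = 2" and pos_Suc: "pos (Suc i) = pos i + length (L (Suc i)) + 1"
  by (simp_all add: pos_def)

lemma pos_le: "i \<le> n \<Longrightarrow> pos i \<le> 2 + i * n"
proof (induction i)
  case (Suc i)
  then show ?case using length_L[of "Suc i"] by (simp add: pos_Suc)
qed (simp add: pos_0)

lemma mult_n_le: "i \<le> n \<Longrightarrow> i * n \<le> n * n"
  by (rule mult_le_mono1)

lemma pos_lt_qB: "i < n \<Longrightarrow> pos i + length (L (Suc i)) \<le> qB"
  using pos_le[of "Suc i"] mult_n_le[of "Suc i"] by (simp add: pos_Suc qB_def)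

lemma n_le_square: "2 * n \<le> n * n" "4 \<le> n * n"
  using n_ge2 mult_le_mono[of 2 n 2 n] by simp_all

lemma layout_bound: "kB + n * n + n + 10 \<le> W" "eB \<le> W"
  using W_square n_le_square min.cobounded2[of \<gamma> "n * n"]
  unfolding eB_def kB_def row_def rB_def dB_def qB_def by linarith+

lemma row_bound: "i \<in> {1..n} \<Longrightarrow> row i + n \<le> kB"
  unfolding kB_def row_def using mult_n_le[of i] by (metis add_le_cancel_left add_le_cancel_right atLeastAtMost_iff)

lemma tables_update:
  assumes "tables m" "qB < a" "a \<le> rB \<or> kB < a"
  shows "tables (m(a := v))"
proof -
  have "pos i \<noteq> a" "j < length (L (Suc i)) \<Longrightarrow> pos i + Suc j \<noteq> a" if "i < n" for i j
    using pos_lt_qB[OF that] assms(2) by auto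
  moreover have "rB + i \<noteq> a" if "i \<in> {1..n}" for i
    using that assms(3) by (auto simp: kB_def row_def)
  moreover have "row i + y \<noteq> a" if "i \<in> {1..n}" "y \<in> {1..n}" for i y
    using that assms(3) row_bound[OF that(1)] by (auto simp: row_def)
  ultimately show ?thesis
    using assms(1) unfolding tables_def lists_stored_def ranks_stored_def by simp
qed

lemma tables_list:
  assumes "tables m" "i < n"
  shows "m (pos i) = length (L (Suc i))" "j < length (L (Suc i)) \<Longrightarrow> m (Suc (pos i + j)) = L (Suc i) ! j"
  using assms by (auto simp: tables_def lists_stored_def)

lemma tables_rank:
  assumes "tables m" "i \<in> {1..n}"
  shows "m (rB + i) = row i" "y \<in> {1..n} \<Longrightarrow> m (row i + y) = rk i y"
  using assms by (auto simp: tables_def ranks_stored_def)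

lemma address_bounds:
  "2 \<le> W" "rB + n \<le> kB" "dB + n \<le> kB" "qB + n \<le> kB" "kB < W" "n \<le> kB"
  using layout_bound(1) n_le_square by (simp_all add: kB_def row_def rB_def dB_def qB_def)

section \<open>Decoding a bit vector\<close>

lemma reset_correct:
  assumes "env R" "tables m"
  shows "runs W reset (10 * n) (\<lambda>(R', m'). env R' \<and> R' Ans = R Ans \<and> tables m' \<and>
    (\<forall>i\<in>{1..n}. m' (qB + i) = 0) \<and> (\<forall>a>kB. m' a = m a)) (R, m)"
proof -
  define I where "I d = (\<lambda>(R', m'). env R' \<and> R' Ans = R Ans \<and> tables m' \<and> R' X = d \<and>
    (\<forall>i\<in>{1..d}. m' (qB + i) = 0) \<and> (\<forall>a>kB. m' a = m a))" for d
  show ?thesis unfolding reset_def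
  proof (rule runs_Seq_le)
    show "runs W (copy X Zero) 1 (I 0) (R, m)"
      by (rule runs_wp_le) (use assms in \<open>simp_all add: I_def env_def\<close>)
  next
    fix s assume s: "I 0 s"
    show "runs W (Loop (LessReg X N) (add X X One ;; add T Qb X ;; store T Zero)) (n * (3 + 1) + 1)
      (\<lambda>(R', m'). env R' \<and> R' Ans = R Ans \<and> tables m' \<and>
        (\<forall>i\<in>{1..n}. m' (qB + i) = 0) \<and> (\<forall>a>kB. m' a = m a)) s"
    proof (rule runs_mono[OF runs_for[where I = I and k = n, OF s order.refl]])
      fix d R m assume I: "I d (R, m)" and "d < n"
      note h = I[unfolded I_def env_def prod.case]
      show "runs W (add X X One ;; add T Qb X ;; store T Zero) 3 (I (Suc d)) (R, m)"
        using address_bounds \<open>d < n\<close>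
        by (intro runs_wp_le) (auto simp: h I_def env_def le_Suc_eq rB_def dB_def intro!: tables_update)
    qed (auto simp: I_def env_def)
  qed (use n_ge2 in auto)
qed

text \<open>Indices past the end of the vector are included because a decoding may read too far;
  these cells are 0, like the high bits of the counter value.\<close>

definition guess_bit :: "(nat \<Rightarrow> nat) \<Rightarrow> nat \<Rightarrow> bool" where
  "guess_bit m k \<longleftrightarrow> m (Suc (kB + k)) \<noteq> 0"

text \<open>Instead of describing the progress made, the invariant says that continuing
  \<open>propose\<close> from here still yields \<open>res\<close>. The last conjunct bounds the
  bits read plus those that the current list may still consume; it keeps \<open>Bp\<close> within
  n^2 cells after \<open>kB\<close>, even on vectors that make the decoding read past their
  end.\<close>

definition proposing :: "nat \<Rightarrow> (nat \<Rightarrow> nat) \<Rightarrow> nat \<Rightarrow> (nat \<Rightarrow> nat) \<times> nat \<Rightarrow> state \<Rightarrow> bool" where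
  "proposing a m0 i res = (\<lambda>(R, m). env R \<and> R Ans = a \<and> tables m \<and> (\<forall>b>kB. m b = m0 b) \<and>
     R X = Suc i \<and> R E = pos i + length (L (Suc i)) \<and> R Ptr = pos (Suc i) \<and>
     (\<exists>j q c. R J = pos i + j \<and> j \<le> length (L (Suc i)) \<and> R Bp = kB + c \<and>
        (\<forall>z\<in>{1..n}. m (qB + z) = q z) \<and>
        propose (guess_bit m0) rk (Suc i) (drop j (L (Suc i))) (q, c) = res \<and>
        c + (length (L (Suc i)) - j) \<le> Suc i * n))"

lemma proposingI:
  assumes "env R" "R Ans = a" "tables m" "\<forall>b>kB. m b = m0 b"
    "R X = Suc i" "R E = pos i + length (L (Suc i))" "R Ptr = pos (Suc i)"
    "R J = pos i + j" "j \<le> length (L (Suc i))" "R Bp = kB + c" "\<forall>z\<in>{1..n}. m (qB + z) = q z"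
    "propose (guess_bit m0) rk (Suc i) (drop j (L (Suc i))) (q, c) = res"
    "c + (length (L (Suc i)) - j) \<le> Suc i * n"
  shows "proposing a m0 i res (R, m)"
  using assms unfolding proposing_def by blast

lemma proposal_correct:
  assumes I: "proposing a m0 i res (R, m)" and i: "i < n" and less: "R J < R E"
  shows "runs W proposal 15
    (\<lambda>s'. proposing a m0 i res s' \<and> fst s' E - fst s' J < R E - R J) (R, m)"
proof -
  let ?x = "Suc i"
  from I obtain j q c where h0: "env R" "R Ans = a" "tables m" "\<forall>b>kB. m b = m0 b"
    "R X = Suc i" "R E = pos i + length (L (Suc i))" "R Ptr = pos (Suc i)"
    "R J = pos i + j" "j \<le> length (L (Suc i))" "R Bp = kB + c" "\<forall>z\<in>{1..n}. m (qB + z) = q z"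
    "propose (guess_bit m0) rk (Suc i) (drop j (L (Suc i))) (q, c) = res"
    "c + (length (L (Suc i)) - j) \<le> Suc i * n" unfolding proposing_def prod.case by blast
  note h = h0[unfolded env_def]
  define y where "y = L ?x ! j"
  have j: "j < length (L ?x)" using less h by simp
  have x: "?x \<in> {1..n}" using i by simp
  have y: "y \<in> {1..n}" "y \<noteq> ?x" using L_nth[OF x j] by (simp_all add: y_def)
  have drop: "drop j (L ?x) = y # drop (Suc j) (L ?x)" using j by (simp add: Cons_nth_drop_Suc y_def)
  have my: "m (Suc (pos i + j)) = y" using tables_list(2)[OF h0(3) i j] by (simp add: y_def)
  have mr: "m (rB + y) = row y" "m (Suc (row y + i)) = rk y ?x"
    using tables_rank(1)[OF h0(3) y(1)] tables_rank(2)[OF h0(3) y(1) x] by simp_all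
  have "c < Suc i * n" using h0(13) j by simp
  moreover have "Suc i * n \<le> n * n" using i by (intro mult_le_mono1) simp
  ultimately have c: "c < Suc i * n" "c < n * n" by simp_all
  have le: "Suc (pos i + j) \<le> W" "rB + y \<le> W" "Suc (row y + i) \<le> W" "Suc (qB + i) \<le> W"
    "qB + y \<le> W" "Suc (kB + c) \<le> W"
    using pos_lt_qB[OF i] row_bound[OF y(1)] y(1) i j c(2) address_bounds layout_bound(1) by simp_all
  have bit: "m (Suc (kB + c)) = m0 (Suc (kB + c))" using h0(4) by simp
  let ?m = "m(Suc (qB + i) := y, qB + y := Suc i)"
  have m': "tables ?m" "\<forall>b>kB. ?m b = m0 b"
    using i y address_bounds h0(3,4) by (auto simp: rB_def dB_def intro!: tables_update)
  have matched: "proposing a m0 i (q(?x := y, y := ?x), c') (R', ?m)"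
    if "env R'" "R' Ans = a" "R' X = Suc i" "R' E = pos i + length (L ?x)" "R' Ptr = pos (Suc i)"
      "R' J = pos i + length (L ?x)" "R' Bp = kB + c'" "c' \<le> Suc i * n"
      "res = (q(?x := y, y := ?x), c')" for R' c'
    by (rule proposingI[where j = "length (L ?x)" and q = "q(?x := y, y := ?x)" and c = c'])
      (use that m' h0(11) in auto)
  have res: "res = (if rk y ?x = 1 then (q(?x := y, y := ?x), c)
      else if m0 (Suc (kB + c)) = 0 then (q(?x := y, y := ?x), Suc c)
      else propose (guess_bit m0) rk ?x (drop (Suc j) (L ?x)) (q, Suc c))"
    unfolding h0(12)[symmetric] drop propose.simps guess_bit_def by simp
  show ?thesis
  proof (rule runs_wp_le)
    show "wp W proposal (\<lambda>s'. proposing a m0 i res s' \<and> fst s' E - fst s' J < R E - R J) (R, m)"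
    proof (cases "rk y ?x = 1 \<or> m0 (Suc (kB + c)) = 0")
      case True
      then show ?thesis
        using c res le j by (auto simp: proposal_def h my mr bit env_def intro!: matched)
    next
      case False
      have "proposing a m0 i res (R', m)"
        if "env R'" "R' Ans = a" "R' X = Suc i" "R' E = pos i + length (L ?x)" "R' Ptr = pos (Suc i)"
          "R' J = Suc (pos i + j)" "R' Bp = Suc (kB + c)" for R'
        by (rule proposingI[where j = "Suc j" and q = q and c = "Suc c"])
          (use that h0 j c res False in auto)
      with False show ?thesis
        using le j by (simp add: proposal_def h my mr bit env_def diff_less_mono2)
    qed
  qed (simp add: proposal_def)
qed

lemma next_list_correct:
  assumes "env R" "R Ans = a" "tables m" "R X = i" "R Ptr = pos i" "i < n"
    "guess (guess_bit m) i = (q, c)" "R Bp = kB + c" "c \<le> i * n" "\<forall>z\<in>{1..n}. m (qB + z) = q z"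
  shows "runs W next_list 9 (proposing a m i (guess (guess_bit m) (Suc i))) (R, m)"
proof -
  note h = assms(2-10) assms(1)[unfolded env_def]
  have len: "c + length (L (Suc i)) \<le> Suc i * n" using length_L[of "Suc i"] assms(6,9) by simp
  have mem: "m (pos i) = length (L (Suc i))" "m (Suc (qB + i)) = q (Suc i)"
    using tables_list(1)[OF assms(3,6)] bspec[OF assms(10), of "Suc i"] assms(6) by simp_all
  have le: "Suc i \<le> W" "pos i + length (L (Suc i)) \<le> W" "Suc (pos i + length (L (Suc i))) \<le> W"
    "Suc (qB + i) \<le> W"
    using pos_lt_qB[OF assms(6)] address_bounds assms(6) by simp_all
  show ?thesis
  proof (rule runs_wp_le)
    show "wp W next_list (proposing a m i (guess (guess_bit m) (Suc i))) (R, m)"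
    proof (cases "q (Suc i) = 0")
      case True
      have "proposing a m i (guess (guess_bit m) (Suc i)) (R', m)"
        if "env R'" "R' Ans = a" "R' X = Suc i" "R' E = pos i + length (L (Suc i))"
          "R' Ptr = pos (Suc i)" "R' J = pos i" "R' Bp = kB + c" for R'
        by (rule proposingI[where j = 0 and q = q and c = c])
          (use that assms len True in auto)
      then show ?thesis using le True by (simp add: next_list_def h mem env_def pos_Suc)
    next
      case False
      have "proposing a m i (guess (guess_bit m) (Suc i)) (R', m)"
        if "env R'" "R' Ans = a" "R' X = Suc i" "R' E = pos i + length (L (Suc i))"
          "R' Ptr = pos (Suc i)" "R' J = pos i + length (L (Suc i))" "R' Bp = kB + c" for R'
        by (rule proposingI[where j = "length (L (Suc i))" and q = q and c = c])
          (use that assms len False in auto)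
      then show ?thesis using le False by (simp add: next_list_def h mem env_def pos_Suc)
    qed
  qed (simp add: next_list_def)
qed

lemma simulate_correct:
  assumes "env R" "tables m" "\<forall>i\<in>{1..n}. m (qB + i) = 0"
  shows "runs W simulate (24 * (n * n)) (\<lambda>(R', m'). env R' \<and> R' Ans = R Ans \<and> tables m' \<and>
    (\<forall>z\<in>{1..n}. m' (qB + z) = fst (guess (guess_bit m) n) z) \<and> (\<forall>b>kB. m' b = m b)) (R, m)"
proof -
  define I where "I d = (\<lambda>(R', m'). env R' \<and> R' Ans = R Ans \<and> tables m' \<and> R' X = d \<and>
    R' Ptr = pos d \<and> (\<forall>b>kB. m' b = m b) \<and>
    (\<exists>q c. guess (guess_bit m) d = (q, c) \<and> R' Bp = kB + c \<and> c \<le> d * n \<and>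
      (\<forall>z\<in>{1..n}. m' (qB + z) = q z)))" for d
  let ?pre = "copy X Zero ;; add Ptr One One ;; copy Bp Kb"
  let ?body = "next_list ;; Loop (LessReg J E) proposal"
  show ?thesis unfolding simulate_def
  proof (rule runs_Seq_le)
    show "runs W ?pre 3 (I 0) (R, m)"
      by (rule runs_wp_le)
        (use assms address_bounds in \<open>simp_all add: I_def env_def pos_0 numeral_2_eq_2\<close>)
  next
    fix s assume s: "I 0 s"
    show "runs W (Loop (LessReg X N) ?body) (n * (9 + (n * 16 + 1) + 1) + 1)
      (\<lambda>(R', m'). env R' \<and> R' Ans = R Ans \<and> tables m' \<and>
        (\<forall>z\<in>{1..n}. m' (qB + z) = fst (guess (guess_bit m) n) z) \<and> (\<forall>b>kB. m' b = m b)) s"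
    proof (rule runs_mono[OF runs_for[where I = I and k = n, OF s order.refl]])
      fix d R1 m1 assume I: "I d (R1, m1)" and d: "d < n"
      then obtain q c where h: "env R1" "R1 Ans = R Ans" "tables m1" "R1 X = d" "R1 Ptr = pos d"
        "\<forall>b>kB. m1 b = m b" "guess (guess_bit m) d = (q, c)" "R1 Bp = kB + c" "c \<le> d * n"
        "\<forall>z\<in>{1..n}. m1 (qB + z) = q z" unfolding I_def by auto
      have bits: "guess_bit m1 = guess_bit m" using h(6) by (auto simp: guess_bit_def fun_eq_iff)
      show "runs W ?body (9 + (n * 16 + 1)) (I (Suc d)) (R1, m1)"
      proof (rule runs_Seq_le[OF next_list_correct[of R1 "R Ans" m1 d q c]])
        fix s1 assume s1: "proposing (R Ans) m1 d (guess (guess_bit m1) (Suc d)) s1"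
        have "length (L (Suc d)) \<le> n" using length_L[of "Suc d"] d by simp
        with s1 have "fst s1 E - fst s1 J \<le> n" by (cases s1) (auto simp: proposing_def)
        then have "runs W (Loop (LessReg J E) proposal) (n * (15 + 1) + 1)
          (\<lambda>s'. proposing (R Ans) m1 d (guess (guess_bit m1) (Suc d)) s' \<and> \<not> holds (LessReg J E) s') s1"
        proof (rule runs_Loop[where f = "\<lambda>s. fst s E - fst s J" and
              I = "proposing (R Ans) m1 d (guess (guess_bit m1) (Suc d))", OF s1])
          fix s assume "proposing (R Ans) m1 d (guess (guess_bit m1) (Suc d)) s" "holds (LessReg J E) s"
          then show "runs W proposal 15 (\<lambda>s'. proposing (R Ans) m1 d (guess (guess_bit m1) (Suc d)) s' \<and>
            fst s' E - fst s' J < fst s E - fst s J) s"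
            using proposal_correct[OF _ d] by (cases s) simp
        qed
        then show "runs W (Loop (LessReg J E) proposal) (n * 16 + 1) (I (Suc d)) s1"
        proof (rule runs_mono)
          fix s2 assume s2: "proposing (R Ans) m1 d (guess (guess_bit m1) (Suc d)) s2 \<and>
            \<not> holds (LessReg J E) s2"
          obtain R2 m2 where s2_eq [simp]: "s2 = (R2, m2)" by (cases s2)
          have s2': "proposing (R Ans) m1 d (guess (guess_bit m1) (Suc d)) (R2, m2)" "\<not> R2 J < R2 E"
            using s2 by simp_all
          then obtain j q c where k: "env R2" "R2 Ans = R Ans" "tables m2" "\<forall>b>kB. m2 b = m1 b"
            "R2 X = Suc d" "R2 E = pos d + length (L (Suc d))" "R2 Ptr = pos (Suc d)"
            "R2 J = pos d + j" "j \<le> length (L (Suc d))" "R2 Bp = kB + c" "\<forall>z\<in>{1..n}. m2 (qB + z) = q z"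
            "propose (guess_bit m1) rk (Suc d) (drop j (L (Suc d))) (q, c) = guess (guess_bit m1) (Suc d)"
            "c + (length (L (Suc d)) - j) \<le> Suc d * n"
            unfolding proposing_def prod.case by blast
          from k s2'(2) have "j = length (L (Suc d))" by simp
          with k(12) have "guess (guess_bit m) (Suc d) = (q, c)" unfolding bits by (metis drop_all order.refl propose.simps(1))
          moreover have "\<forall>b>kB. m2 b = m b" using k(4) h(6) by simp
          ultimately show "I (Suc d) s2" using k unfolding I_def by simp
        qed simp
      qed (use h d bits in auto)
    qed (auto simp: I_def env_def)
  next
    have "3 + (n * (9 + (n * 16 + 1) + 1) + 1) = 16 * (n * n) + 11 * n + 4"
      by (simp add: algebra_simps)
    then show "3 + (n * (9 + (n * 16 + 1) + 1) + 1) \<le> 24 * (n * n)"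
      using n_le_square by linarith
  qed
qed

section \<open>Checking the decoded candidate\<close>

lemma propose_le:
  assumes "set ys \<subseteq> {1..n}" "x \<le> n" "\<And>z. fst s z \<le> n"
  shows "fst (propose \<beta> rk x ys s) z \<le> n"
  using assms
proof (induction ys arbitrary: s)
  case (Cons y ys)
  show ?case using Cons.prems Cons.IH[of "(fst s, Suc (snd s))"] by (cases s) auto
qed simp

text \<open>Needed for arbitrary bits, not only for those that describe a matching, because
  \<open>validate\<close> computes addresses from the entries before it knows whether they make
  sense.\<close>

lemma guess_le: "k \<le> n \<Longrightarrow> fst (guess \<beta> k) z \<le> n"
proof (induction k arbitrary: z)
  case (Suc k)
  then show ?case using propose_le[of "L (Suc k)" "Suc k" "guess \<beta> k"] L_subset[of "Suc k"] by auto
qed simp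

lemma validate_correct:
  assumes "env R" "tables m" and q: "\<forall>z\<in>{1..n}. m (qB + z) = q z" "\<forall>z\<in>{1..n}. q z \<le> n"
  shows "runs W validate (28 * n) (\<lambda>(R', m'). env R' \<and> R' Ans = R Ans \<and> tables m' \<and>
    (\<forall>b>kB. m' b = m b) \<and> (\<forall>z\<in>{1..n}. m' (dB + z) = dis q z) \<and>
    (R' Bad = 0 \<longleftrightarrow> (\<forall>x\<in>{1..n}. valid_at q x) \<and> sum (dis q) {1..n} \<le> \<gamma>)) (R, m)"
proof -
  define I where "I d = (\<lambda>(R', m'). env R' \<and> R' Ans = R Ans \<and> tables m' \<and> R' X = d \<and>
    R' Ptr = pos d \<and> (\<forall>b>kB. m' b = m b) \<and> (\<forall>z\<in>{1..n}. m' (qB + z) = q z) \<and>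
    (\<forall>z\<in>{1..d}. m' (dB + z) = dis q z) \<and> R' Cost = sum (dis q) {1..d} \<and>
    (R' Bad = 0 \<longleftrightarrow> (\<forall>x\<in>{1..d}. valid_at q x)))" for d
  show ?thesis unfolding validate_def
  proof (rule runs_Seq_le)
    show "runs W (copy X Zero ;; add Ptr One One ;; copy Bad Zero ;; copy Cost Zero) 4 (I 0) (R, m)"
      by (rule runs_wp_le)
        (use assms address_bounds in \<open>simp_all add: I_def env_def pos_0 numeral_2_eq_2\<close>)
  next
    fix s assume s: "I 0 s"
    show "runs W (Loop (LessReg X N)
       (add X X One ;; load U Ptr ;; add Ptr Ptr U ;; add Ptr Ptr One ;;
        add T Qb X ;; load Y T ;;
        Branch (EqReg Y Zero) skip
          (add T Qb Y ;; load T T ;;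
           Branch (EqReg T X) skip (copy Bad One) ;;
           add T Rb X ;; load T T ;; add T T Y ;; load U T ;;
           Branch (EqReg U Zero) (copy Bad One) (sub U U One)) ;;
        add T Db X ;; store T U ;; add Cost Cost U) ;;
       Branch (LessReg G Cost) (copy Bad One) skip) (n * (20 + 1) + 1 + 2)
      (\<lambda>(R', m'). env R' \<and> R' Ans = R Ans \<and> tables m' \<and>
        (\<forall>b>kB. m' b = m b) \<and> (\<forall>z\<in>{1..n}. m' (dB + z) = dis q z) \<and>
        (R' Bad = 0 \<longleftrightarrow> (\<forall>x\<in>{1..n}. valid_at q x) \<and> sum (dis q) {1..n} \<le> \<gamma>)) s"
    proof (rule runs_Seq_le[OF runs_for[where I = I and k = n, OF s order.refl] _ order.refl])
      fix d R1 m1 assume I: "I d (R1, m1)" and d: "d < n"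
      note h = I[unfolded I_def env_def prod.case]
      have h': "tables m1" "\<forall>z\<in>{1..n}. m1 (qB + z) = q z" using h by blast+
      have h0: "R1 One = 1" "R1 Zero = 0" "R1 N = n" "R1 G = \<gamma>" "R1 Sq = n * n" "R1 Qb = qB" "R1 Db = dB"
        "R1 Rb = rB" "R1 Kb = kB" "R1 Eb = eB" "R1 Ans = R Ans" "R1 X = d" "R1 Ptr = pos d"
        "R1 Cost = sum (dis q) {1..d}"
        using h by blast+
      define x where "x = Suc d"
      have x: "x \<in> {1..n}" using d by (simp add: x_def)
      have mem: "m1 (pos d) = length (L x)" "m1 (qB + x) = q x"
        using tables_list(1)[OF h'(1) d] bspec[OF h'(2) x] by (simp_all add: x_def)
      have mem': "m1 (qB + q x) = q (q x)" "m1 (rB + x) = row x" "m1 (row x + q x) = rk x (q x)"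
        if "q x \<noteq> 0"
      proof -
        have "q x \<in> {1..n}" using that q(2) x by auto
        then show "m1 (qB + q x) = q (q x)" "m1 (rB + x) = row x" "m1 (row x + q x) = rk x (q x)"
          using h'(2) tables_rank[OF h'(1) x] by blast+
      qed
      have cost: "sum (dis q) {1..Suc d} = sum (dis q) {1..d} + dis q x"
        by (simp add: x_def)
      \<comment> \<open>The partial cost must fit into a word before it is compared with \<gamma>,
        hence a bound independent of \<gamma>.\<close>
      have "sum (dis q) {1..Suc d} \<le> (\<Sum>x\<in>{1..Suc d}. n)" by (intro sum_mono dis_le) (use d in auto)
      also have "\<dots> \<le> n * n" using d by (simp del: mult_Suc)
      finally have cost_le: "sum (dis q) {1..d} + dis q x \<le> n * n" using cost by simp
      have rng: "q x \<le> n" using q(2) x by blast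
      have le: "x \<le> W" "pos d + length (L x) \<le> W" "Suc (pos d + length (L x)) \<le> W"
        "qB + x \<le> W" "qB + q x \<le> W" "rB + x \<le> W" "row x + q x \<le> W" "dB + x \<le> W"
        "sum (dis q) {1..d} + dis q x \<le> W"
        using pos_lt_qB[OF d] address_bounds layout_bound(1) row_bound[OF x] x rng cost_le
        unfolding x_def[symmetric] by simp_all
      have tab: "tables (m1(dB + x := v))" for v
        using h'(1) x by (intro tables_update) (auto simp: dB_def rB_def)
      have neq: "kB < b \<Longrightarrow> b \<noteq> dB + x" "z \<in> {1..n} \<Longrightarrow> qB + z \<noteq> dB + x" for b z
        using x address_bounds by (auto simp: dB_def)
      have posx: "pos x = Suc (pos d + length (L x))" by (simp add: x_def pos_Suc)
      have ivl: "{1..x} = insert x {1..d}" by (auto simp: x_def)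
      have h'': "\<forall>b>kB. m1 b = m b" "\<forall>z\<in>{1..d}. m1 (dB + z) = dis q z"
        "(R1 Bad = 0) = (\<forall>x\<in>{1..d}. valid_at q x)" using h by blast+
      have goal: "I x (R', m1(dB + x := v))"
        if v: "v = dis q x" and "env R'" "R' Ans = R Ans" "R' X = x" "R' Ptr = pos x"
          "R' Cost = sum (dis q) {1..d} + dis q x" "R' Bad = 0 \<longleftrightarrow> R1 Bad = 0 \<and> valid_at q x" for R' v
        unfolding I_def prod.case v
      proof (intro conjI)
        show "\<forall>b>kB. (m1(dB + x := dis q x)) b = m b" using h''(1) neq(1) by simp
        show "\<forall>z\<in>{1..n}. (m1(dB + x := dis q x)) (qB + z) = q z" using h'(2) neq(2) by simp
        show "\<forall>z\<in>{1..x}. (m1(dB + x := dis q x)) (dB + z) = dis q z"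
          unfolding ivl using h''(2) by simp
        show "R' Cost = sum (dis q) {1..x}" unfolding that x_def by simp
        show "(R' Bad = 0) = (\<forall>x\<in>{1..x}. valid_at q x)" unfolding ivl that h''(3) by auto
      qed (use that tab in auto)
      show "runs W (add X X One ;; load U Ptr ;; add Ptr Ptr U ;; add Ptr Ptr One ;;
        add T Qb X ;; load Y T ;;
        Branch (EqReg Y Zero) skip
          (add T Qb Y ;; load T T ;;
           Branch (EqReg T X) skip (copy Bad One) ;;
           add T Rb X ;; load T T ;; add T T Y ;; load U T ;;
           Branch (EqReg U Zero) (copy Bad One) (sub U U One)) ;;
        add T Db X ;; store T U ;; add Cost Cost U) 20 (I (Suc d)) (R1, m1)"
      proof (rule runs_wp_le, unfold x_def[symmetric])
        show "wp W (add X X One ;; load U Ptr ;; add Ptr Ptr U ;; add Ptr Ptr One ;;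
          add T Qb X ;; load Y T ;;
          Branch (EqReg Y Zero) skip
            (add T Qb Y ;; load T T ;;
             Branch (EqReg T X) skip (copy Bad One) ;;
             add T Rb X ;; load T T ;; add T T Y ;; load U T ;;
             Branch (EqReg U Zero) (copy Bad One) (sub U U One)) ;;
          add T Db X ;; store T U ;; add Cost Cost U) (I x) (R1, m1)"
        proof (cases "q x = 0")
          case True
          then have dis: "dis q x = length (L x)" by (simp add: dis_def)
          show ?thesis using le unfolding dis
            by (simp add: h0 x_def[symmetric] mem True, intro goal)
              (simp_all add: dis h0 env_def valid_at_def True posx)
        next
          case False
          note mem' = mem'[OF this]
          show ?thesis
          proof (cases "rk x (q x) = 0")
            case True
            then have dis: "dis q x = 0" using False by (simp add: dis_def)
            show ?thesis using le unfolding dis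
              by (simp add: h0 x_def[symmetric] mem mem' True False, intro conjI impI goal)
                (simp_all add: dis h0 env_def valid_at_def True False posx)
          next
            case rk: False
            then have dis: "rk x (q x) = Suc (dis q x)" using False by (simp add: dis_def)
            show ?thesis using le
              by (simp add: h0 x_def[symmetric] mem mem' dis False, intro conjI impI goal)
                (simp_all add: dis h0 env_def valid_at_def False posx)
          qed
        qed
      qed simp
    next
      fix s assume "I n s"
      then show "runs W (Branch (LessReg G Cost) (copy Bad One) skip) 2
        (\<lambda>(R', m'). env R' \<and> R' Ans = R Ans \<and> tables m' \<and>
        (\<forall>b>kB. m' b = m b) \<and> (\<forall>z\<in>{1..n}. m' (dB + z) = dis q z) \<and>
        (R' Bad = 0 \<longleftrightarrow> (\<forall>x\<in>{1..n}. valid_at q x) \<and> sum (dis q) {1..n} \<le> \<gamma>)) s"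
        by (intro runs_wp_le; cases s) (auto simp: I_def env_def not_less)
    qed (auto simp: I_def env_def)
  qed (use n_ge2 in simp)
qed

lemma check_pairs_correct:
  assumes "env R" "tables m" and q: "\<forall>z\<in>{1..n}. m (dB + z) = dis q z"
  shows "runs W check_pairs (22 * (n * n)) (\<lambda>(R', m'). env R' \<and> R' Ans = R Ans \<and> m' = m \<and>
    (R' Bad = 0 \<longleftrightarrow> R Bad = 0 \<and> (\<forall>x\<in>{1..n}. \<forall>y\<in>{1..n}. \<not> blocking q x y))) (R, m)"
proof -
  define I where "I d = (\<lambda>(R', m'). env R' \<and> R' Ans = R Ans \<and> m' = m \<and> R' X = d \<and>
    (R' Bad = 0 \<longleftrightarrow> R Bad = 0 \<and> (\<forall>x\<in>{1..d}. \<forall>y\<in>{1..n}. \<not> blocking q x y)))" for d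
  let ?pre = "add X X One ;; copy Y Zero ;; add T Rb X ;; load Row T ;; add T Db X ;; load E T"
  have inner: "runs W (Loop (LessReg Y N) check_pair) (n * (14 + 1) + 1) (I x) s"
    if x: "x \<in> {1..n}" and s: "\<exists>R1. s = (R1, m) \<and> env R1 \<and> R1 Ans = R Ans \<and> R1 X = x \<and> R1 Y = 0 \<and>
      R1 Row = row x \<and> R1 E = dis q x \<and>
      (R1 Bad = 0 \<longleftrightarrow> R Bad = 0 \<and> (\<forall>z\<in>{1..x - 1}. \<forall>y\<in>{1..n}. \<not> blocking q z y))" for x s
  proof -
    define K where "K e = (\<lambda>(R', m'). env R' \<and> R' Ans = R Ans \<and> m' = m \<and> R' X = x \<and> R' Y = e \<and>
      R' Row = row x \<and> R' E = dis q x \<and>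
      (R' Bad = 0 \<longleftrightarrow> R Bad = 0 \<and> (\<forall>z\<in>{1..x - 1}. \<forall>y\<in>{1..n}. \<not> blocking q z y) \<and>
        (\<forall>y\<in>{1..e}. \<not> blocking q x y)))" for e
    have "K 0 s" using s by (auto simp: K_def)
    then show ?thesis
    proof (rule runs_mono[OF runs_for[where I = K and k = n, OF _ order.refl]])
      fix e R1 m1 assume K: "K e (R1, m1)" and e: "e < n"
      note h = K[unfolded K_def env_def prod.case]
      define y where "y = Suc e"
      have y: "y \<in> {1..n}" using e by (simp add: y_def)
      have mem: "m (row x + y) = rk x y" "m (rB + y) = row y" "m (row y + x) = rk y x" "m (dB + y) = dis q y"
        using tables_rank[OF assms(2)] x y q by blast+
      have le: "y \<le> W" "row x + y \<le> W" "rB + y \<le> W" "row y + x \<le> W" "dB + y \<le> W"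
        using address_bounds row_bound[OF x] row_bound[OF y] x y by simp_all
      have ivl: "{1..y} = insert y {1..e}" by (auto simp: y_def)
      have goal: "K y (R', m)"
        if "env R'" "R' Ans = R Ans" "R' X = x" "R' Y = y" "R' Row = row x" "R' E = dis q x"
          "R' Bad = 0 \<longleftrightarrow> R1 Bad = 0 \<and> \<not> blocking q x y" for R'
      proof -
        have "R1 Bad = 0 \<longleftrightarrow> R Bad = 0 \<and> (\<forall>z\<in>{1..x - 1}. \<forall>y\<in>{1..n}. \<not> blocking q z y) \<and>
          (\<forall>y\<in>{1..e}. \<not> blocking q x y)" using h by blast
        then have "R' Bad = 0 \<longleftrightarrow> R Bad = 0 \<and> (\<forall>z\<in>{1..x - 1}. \<forall>y\<in>{1..n}. \<not> blocking q z y) \<and>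
          (\<forall>y\<in>{1..y}. \<not> blocking q x y)" unfolding that(7) ivl by blast
        then show ?thesis using that(1-6) by (simp add: K_def)
      qed
      have h0: "m1 = m" "R1 One = 1" "R1 Zero = 0" "R1 N = n" "R1 G = \<gamma>" "R1 Sq = n * n" "R1 Qb = qB"
        "R1 Db = dB" "R1 Rb = rB" "R1 Kb = kB" "R1 Eb = eB" "R1 Ans = R Ans" "R1 X = x" "R1 Y = e"
        "R1 Row = row x" "R1 E = dis q x"
        using h by blast+
      show "runs W check_pair 14 (K (Suc e)) (R1, m1)" unfolding y_def[symmetric]
      proof (rule runs_wp_le)
        show "wp W check_pair (K y) (R1, m1)" using le
          by (simp add: check_pair_def h0 y_def[symmetric] mem, intro conjI impI goal)
            (auto simp: h0 env_def blocking_def)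
      qed (simp add: check_pair_def)
    next
      fix s' assume "K n s'"
      moreover have "{1..x} = insert x {1..x - 1}" using x by auto
      ultimately show "I x s'" by (auto simp: K_def I_def)
    qed (auto simp: K_def env_def)
  qed
  show ?thesis unfolding check_pairs_def
  proof (rule runs_Seq_le)
    show "runs W (copy X Zero) 1 (I 0) (R, m)"
      by (rule runs_wp_le) (use assms in \<open>simp_all add: I_def env_def\<close>)
  next
    fix s assume s: "I 0 s"
    show "runs W (Loop (LessReg X N) (?pre ;; Loop (LessReg Y N) check_pair))
      (n * (6 + (n * (14 + 1) + 1) + 1) + 1) (\<lambda>(R', m'). env R' \<and> R' Ans = R Ans \<and> m' = m \<and>
       (R' Bad = 0 \<longleftrightarrow> R Bad = 0 \<and> (\<forall>x\<in>{1..n}. \<forall>y\<in>{1..n}. \<not> blocking q x y))) s"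
    proof (rule runs_mono[OF runs_for[where I = I and k = n, OF s order.refl]])
      fix d R1 m1 assume I: "I d (R1, m1)" and d: "d < n"
      note h = I[unfolded I_def env_def prod.case]
      have x: "Suc d \<in> {1..n}" using d by simp
      have mem: "m (Suc (rB + d)) = row (Suc d)" "m (Suc (dB + d)) = dis q (Suc d)"
        using tables_rank(1)[OF assms(2) x] bspec[OF q x] by simp_all
      show "runs W (?pre ;; Loop (LessReg Y N) check_pair) (6 + (n * (14 + 1) + 1)) (I (Suc d)) (R1, m1)"
      proof (rule runs_Seq_wp)
        show "wp W ?pre (runs W (Loop (LessReg Y N) check_pair) (n * (14 + 1) + 1) (I (Suc d))) (R1, m1)"
          using address_bounds d mem inner[OF x] h by (simp add: env_def)
      qed simp
    qed (auto simp: I_def env_def)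
  next
    have "1 + (n * (6 + (n * (14 + 1) + 1) + 1) + 1) = 15 * (n * n) + 8 * n + 2"
      by (simp add: algebra_simps)
    then show "1 + (n * (6 + (n * (14 + 1) + 1) + 1) + 1) \<le> 22 * (n * n)"
      using n_le_square by linarith
  qed
qed

end

text \<open>The carry reaches bit \<open>d\<close> iff all lower bits of \<open>v\<close> are 1,
  that is, iff \<open>2 ^ d\<close> divides \<open>Suc v\<close>. The two facts are the carry rule
  and the sum rule of one position.\<close>

lemma power_dvd_Suc_iff: "2 ^ Suc d dvd Suc v \<longleftrightarrow> 2 ^ d dvd Suc v \<and> bit v d"
  and bit_Suc_iff: "bit (Suc v) d \<longleftrightarrow> (bit v d \<noteq> (2 ^ d dvd Suc v))"
proof -
  have div: "Suc v div 2 ^ d = v div 2 ^ d + of_bool (2 ^ d dvd Suc v)"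
    by (simp add: div_Suc dvd_eq_mod_eq_0)
  show "bit (Suc v) d \<longleftrightarrow> (bit v d \<noteq> (2 ^ d dvd Suc v))"
    by (simp add: bit_iff_odd div)
  have "2 ^ Suc d dvd Suc v \<longleftrightarrow> 2 ^ d dvd Suc v \<and> even (Suc v div 2 ^ d)"
    by (auto simp: mult.commute[of 2] dvd_def elim!: evenE)
  then show "2 ^ Suc d dvd Suc v \<longleftrightarrow> 2 ^ d dvd Suc v \<and> bit v d"
    by (auto simp: div bit_iff_odd)
qed

section \<open>The binary counter and one complete attempt\<close>

context roommates_ram
begin

definition nbits :: nat where "nbits = min \<gamma> (n * n)"

lemma increment_correct:
  assumes "env R" "tables m" and v: "v < 2 ^ nbits"
    and bits: "\<And>k. m (Suc (kB + k)) = of_bool (bit v k)"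
  shows "runs W increment (12 * (n * n)) (\<lambda>(R', m'). env R' \<and> R' Ans = R Ans \<and> tables m' \<and>
    R' Carry = of_bool (Suc v = 2 ^ nbits) \<and>
    (Suc v < 2 ^ nbits \<longrightarrow> (\<forall>k. m' (Suc (kB + k)) = of_bool (bit (Suc v) k)))) (R, m)"
proof -
  define I where "I d = (\<lambda>(R', m'). env R' \<and> R' Ans = R Ans \<and> tables m' \<and> R' J = kB + d \<and>
    R' Carry = of_bool (2 ^ d dvd Suc v) \<and>
    (\<forall>k. m' (Suc (kB + k)) = of_bool (bit (if k < d then Suc v else v) k)))" for d
  let ?body = "add J J One ;;
        Branch (EqReg Carry One)
          (load U J ;; Branch (EqReg U One) (store J Zero) (store J One ;; copy Carry Zero))
          skip"
  show ?thesis unfolding increment_def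
  proof (rule runs_Seq_le)
    show "runs W (copy Carry One ;; copy J Kb) 2 (I 0) (R, m)"
      by (rule runs_wp_le) (use assms in \<open>simp_all add: I_def env_def\<close>)
  next
    fix s assume s: "I 0 s"
    show "runs W (Loop (LessReg J Eb) ?body) (nbits * (6 + 1) + 1)
      (\<lambda>(R', m'). env R' \<and> R' Ans = R Ans \<and> tables m' \<and>
        R' Carry = of_bool (Suc v = 2 ^ nbits) \<and>
        (Suc v < 2 ^ nbits \<longrightarrow> (\<forall>k. m' (Suc (kB + k)) = of_bool (bit (Suc v) k)))) s"
    proof (rule runs_mono[OF runs_for[where I = I and k = nbits, OF s order.refl]])
      fix d R1 m1 assume I: "I d (R1, m1)" and d: "d < nbits"
      have h0: "R1 One = 1" "R1 Zero = 0" "R1 N = n" "R1 G = \<gamma>" "R1 Sq = n * n" "R1 Qb = qB" "R1 Db = dB"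
        "R1 Rb = rB" "R1 Kb = kB" "R1 Eb = eB" "R1 Ans = R Ans" "R1 J = kB + d"
        "R1 Carry = of_bool (2 ^ d dvd Suc v)" "tables m1"
        and mem: "\<And>k. m1 (Suc (kB + k)) = of_bool (bit (if k < d then Suc v else v) k)"
        using I unfolding I_def env_def by auto
      have le: "Suc (kB + d) \<le> W" using d layout_bound(2) unfolding nbits_def eB_def by linarith
      have tab: "tables (m1(Suc (kB + d) := b))" for b
        using h0(14) address_bounds by (intro tables_update) simp_all
      show "runs W ?body 6 (I (Suc d)) (R1, m1)"
      proof (rule runs_wp_le)
        show "wp W ?body (I (Suc d)) (R1, m1)"
        proof (cases "2 ^ d dvd Suc v")
          case True
          then show ?thesis using le tab
            by (auto simp: h0 mem I_def env_def power_dvd_Suc_iff bit_Suc_iff less_Suc_eq simp del: power_Suc)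
        next
          case False
          then show ?thesis using le h0(14)
            by (auto simp: h0 mem I_def env_def power_dvd_Suc_iff bit_Suc_iff less_Suc_eq simp del: power_Suc)
        qed
      qed simp
    next
      fix s assume I: "I nbits s"
      \<comment> \<open>The carry out of the last position: \<open>Suc v\<close> is positive and at
        most \<open>2 ^ nbits\<close>.\<close>
      have "2 ^ nbits dvd Suc v \<longleftrightarrow> Suc v = 2 ^ nbits" using v by (auto dest: dvd_imp_le)
      \<comment> \<open>Positions from \<open>nbits\<close> on are not scanned, but there both
        \<open>v\<close> and \<open>Suc v\<close> have bit 0.\<close>
      moreover have "bit (if k < nbits then Suc v else v) k = bit (Suc v) k" if "Suc v < 2 ^ nbits" for k
      proof (cases "k < nbits")
        case False
        then have "Suc v < 2 ^ k" using that by (meson less_le_trans not_less one_le_numeral power_increasing)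
        then show ?thesis using False by (simp add: bit_iff_odd)
      qed simp
      ultimately show "case s of (R', m') \<Rightarrow> env R' \<and> R' Ans = R Ans \<and> tables m' \<and>
        R' Carry = of_bool (Suc v = 2 ^ nbits) \<and>
        (Suc v < 2 ^ nbits \<longrightarrow> (\<forall>k. m' (Suc (kB + k)) = of_bool (bit (Suc v) k)))"
        using I by (auto simp: I_def)
    qed (auto simp: I_def env_def eB_def nbits_def)
  next
    have "nbits \<le> n * n" by (simp add: nbits_def)
    then show "2 + (nbits * (6 + 1) + 1) \<le> 12 * (n * n)" using n_le_square by simp
  qed
qed

lemma attempt_correct:
  assumes "env R" "tables m" and v: "v < 2 ^ nbits"
    and bits: "\<And>k. m (Suc (kB + k)) = of_bool (bit v k)"
  shows "runs W attempt (80 * (n * n)) (\<lambda>(R', m'). env R' \<and> tables m' \<and>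
    R' Ans = (if good \<gamma> (fst (guess (bit v) n)) then 1 else R Ans) \<and>
    R' Carry = of_bool (Suc v = 2 ^ nbits) \<and>
    (Suc v < 2 ^ nbits \<longrightarrow> (\<forall>k. m' (Suc (kB + k)) = of_bool (bit (Suc v) k)))) (R, m)"
proof -
  define q where "q = fst (guess (bit v) n)"
  define A1 where "A1 = (\<lambda>(R', m'). env R' \<and> R' Ans = R Ans \<and> tables m' \<and>
    (\<forall>k. m' (Suc (kB + k)) = of_bool (bit v k)))"
  define A2 where "A2 = (\<lambda>(R', m'). A1 (R', m') \<and> (\<forall>i\<in>{1..n}. m' (qB + i) = 0))"
  define A3 where "A3 = (\<lambda>(R', m'). A1 (R', m') \<and> (\<forall>i\<in>{1..n}. m' (qB + i) = q i))"
  define A4 where "A4 = (\<lambda>(R', m'). A1 (R', m') \<and> (\<forall>i\<in>{1..n}. m' (dB + i) = dis q i) \<and>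
    (R' Bad = 0 \<longleftrightarrow> (\<forall>x\<in>{1..n}. valid_at q x) \<and> sum (dis q) {1..n} \<le> \<gamma>))"
  define A5 where "A5 = (\<lambda>(R', m'). A1 (R', m') \<and> (R' Bad = 0 \<longleftrightarrow> good \<gamma> q))"
  define A6 where "A6 = (\<lambda>(R', m'). env R' \<and> tables m' \<and> R' Ans = (if good \<gamma> q then 1 else R Ans) \<and>
    (\<forall>k. m' (Suc (kB + k)) = of_bool (bit v k)))"
  have above: "(\<forall>b>kB. m2 b = m1 b) \<Longrightarrow> A1 (R1, m1) \<Longrightarrow> m2 (Suc (kB + k)) = of_bool (bit v k)"
    for m1 m2 R1 k by (simp add: A1_def)
  have 1: "runs W reset (10 * n) A2 (R, m)"
    by (rule runs_mono[OF reset_correct[OF assms(1,2)] order.refl]) (auto simp: A1_def A2_def bits)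
  have 2: "runs W simulate (24 * (n * n)) A3 s" if "A2 s" for s
  proof -
    obtain R1 m1 where s: "s = (R1, m1)" by (cases s)
    have A: "A1 (R1, m1)" "\<forall>i\<in>{1..n}. m1 (qB + i) = 0" using that by (simp_all add: A2_def s)
    then have B: "env R1" "tables m1" and bit: "guess_bit m1 = bit v"
      by (auto simp: A1_def guess_bit_def fun_eq_iff)
    show ?thesis unfolding s
      by (rule runs_mono[OF simulate_correct[OF B A(2)] order.refl])
        (use A(1) above[OF _ A(1)] in \<open>auto simp: A1_def A3_def q_def bit\<close>)
  qed
  have 3: "runs W validate (28 * n) A4 s" if "A3 s" for s
  proof -
    obtain R1 m1 where s: "s = (R1, m1)" by (cases s)
    have A: "A1 (R1, m1)" "\<forall>i\<in>{1..n}. m1 (qB + i) = q i" using that by (simp_all add: A3_def s)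
    then have B: "env R1" "tables m1" by (auto simp: A1_def)
    have le: "\<forall>i\<in>{1..n}. q i \<le> n" by (simp add: q_def guess_le)
    show ?thesis unfolding s
      by (rule runs_mono[OF validate_correct[OF B A(2) le] order.refl])
        (use A(1) above[OF _ A(1)] in \<open>auto simp: A1_def A4_def\<close>)
  qed
  have 4: "runs W check_pairs (22 * (n * n)) A5 s" if "A4 s" for s
  proof -
    obtain R1 m1 where s: "s = (R1, m1)" by (cases s)
    have A: "A1 (R1, m1)" "\<forall>i\<in>{1..n}. m1 (dB + i) = dis q i"
      "R1 Bad = 0 \<longleftrightarrow> (\<forall>x\<in>{1..n}. valid_at q x) \<and> sum (dis q) {1..n} \<le> \<gamma>"
      using that by (simp_all add: A4_def s)
    then have B: "env R1" "tables m1" by (auto simp: A1_def)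
    show ?thesis unfolding s
      by (rule runs_mono[OF check_pairs_correct[OF B A(2)] order.refl])
        (use A(1,3) in \<open>auto simp: A1_def A5_def good_def\<close>)
  qed
  have 5: "runs W (Branch (EqReg Bad Zero) (copy Ans One) skip) 2 A6 s" if "A5 s" for s
    by (rule runs_wp_le; cases s) (use that in \<open>auto simp: A5_def A1_def A6_def env_def\<close>)
  have 6: "runs W increment (12 * (n * n)) (\<lambda>(R', m'). env R' \<and> tables m' \<and>
    R' Ans = (if good \<gamma> (fst (guess (bit v) n)) then 1 else R Ans) \<and>
    R' Carry = of_bool (Suc v = 2 ^ nbits) \<and>
    (Suc v < 2 ^ nbits \<longrightarrow> (\<forall>k. m' (Suc (kB + k)) = of_bool (bit (Suc v) k)))) s" if "A6 s" for s
  proof -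
    obtain R1 m1 where s: "s = (R1, m1)" by (cases s)
    have B: "env R1" "tables m1" "\<And>k. m1 (Suc (kB + k)) = of_bool (bit v k)"
      using that by (auto simp: A6_def s)
    show ?thesis unfolding s
      by (rule runs_mono[OF increment_correct[OF B(1,2) v B(3)] order.refl])
        (use that in \<open>auto simp: A6_def q_def s\<close>)
  qed
  have "runs W attempt (10 * n + (24 * (n * n) + (28 * n + (22 * (n * n) + (2 + 12 * (n * n))))))
    (\<lambda>(R', m'). env R' \<and> tables m' \<and>
    R' Ans = (if good \<gamma> (fst (guess (bit v) n)) then 1 else R Ans) \<and>
    R' Carry = of_bool (Suc v = 2 ^ nbits) \<and>
    (Suc v < 2 ^ nbits \<longrightarrow> (\<forall>k. m' (Suc (kB + k)) = of_bool (bit (Suc v) k)))) (R, m)"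
    unfolding attempt_def
    by (rule runs_Seq_le[OF 1 _ order.refl], rule runs_Seq_le[OF 2 _ order.refl], assumption,
      rule runs_Seq_le[OF 3 _ order.refl], assumption, rule runs_Seq_le[OF 4 _ order.refl], assumption,
      rule runs_Seq_le[OF 5 6 order.refl])
  \<comment> \<open>The sum is 58 n^2 + 38 n + 2, and \<open>2 * n \<le> n * n\<close> absorbs the
    linear term.\<close>
  then show ?thesis
    by (rule runs_mono) (use n_le_square in linarith)
qed

section \<open>Preprocessing: constants, addresses and the rank table\<close>

definition pre_env :: "(nat \<Rightarrow> nat) \<Rightarrow> bool" where
  "pre_env R \<longleftrightarrow> R One = 1 \<and> R Zero = 0 \<and> R N = n \<and> R G = \<gamma> \<and> R Sq = n * n \<and>
     R Qb = qB \<and> R Db = dB \<and> R Rb = rB \<and> R Ans = 0"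

definition filled :: "nat \<Rightarrow> (nat \<Rightarrow> nat) \<Rightarrow> bool" where
  "filled d m \<longleftrightarrow> lists_stored m \<and>
     (\<forall>i\<in>{1..d}. m (rB + i) = row i \<and> (\<forall>y\<in>{1..n}. m (row i + y) = rk i y))"

lemma row_mono: "i < x \<Longrightarrow> row i + n \<le> row x"
proof -
  assume "i < x"
  then have "Suc i * n \<le> x * n" by (intro mult_le_mono1) simp
  then show ?thesis by (simp add: row_def)
qed

lemma filled_update:
  assumes "filled d m" "qB < a" "a \<notin> {rB + 1..rB + d}" "row d + n < a \<or> a \<le> rB + n"
  shows "filled d (m(a := v))"
proof -
  have "pos i \<noteq> a" "j < length (L (Suc i)) \<Longrightarrow> pos i + Suc j \<noteq> a" if "i < n" for i j
    using pos_lt_qB[OF that] assms(2) by auto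
  moreover have "rB + i \<noteq> a" if "i \<in> {1..d}" for i
    using that assms(3) by auto
  moreover have "row i + y \<noteq> a" if "i \<in> {1..d}" "y \<in> {1..n}" for i y
  proof -
    have "row i \<le> row d" using that(1) row_mono[of i d] by (cases "i = d") auto
    moreover have "rB + n \<le> row i" using row_mono[of 0 i] that(1) by (simp add: row_def)
    ultimately show ?thesis using that(2) assms(4) by auto
  qed
  ultimately show ?thesis
    using assms(1) unfolding filled_def lists_stored_def by simp
qed

lemma square_correct:
  assumes "m 0 = n" "m 1 = \<gamma>"
  shows "runs W square (3 + (n * (2 + 1) + 1)) (\<lambda>(R', m'). m' = m \<and> R' One = 1 \<and> R' Zero = 0 \<and>
    R' N = n \<and> R' G = \<gamma> \<and> R' Sq = n * n \<and> R' Ans = 0) ((\<lambda>_. 0), m)"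
proof -
  define I where "I d = (\<lambda>(R', m'). m' = m \<and> R' One = 1 \<and> R' Zero = 0 \<and>
    R' N = n \<and> R' G = \<gamma> \<and> R' X = d \<and> R' Sq = d * n \<and> R' Ans = 0)" for d
  show ?thesis unfolding square_def
  proof (rule runs_Seq_le[OF _ _ order.refl])
    show "runs W (const One 1 ;; load N Zero ;; load G One) 3 (I 0) ((\<lambda>_. 0), m)"
      by (rule runs_wp_le) (use assms address_bounds in \<open>auto simp: I_def\<close>)
  next
    fix s assume s: "I 0 s"
    show "runs W (Loop (LessReg X N) (add X X One ;; add Sq Sq N)) (n * (2 + 1) + 1)
      (\<lambda>(R', m'). m' = m \<and> R' One = 1 \<and> R' Zero = 0 \<and>
        R' N = n \<and> R' G = \<gamma> \<and> R' Sq = n * n \<and> R' Ans = 0) s"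
    proof (rule runs_mono[OF runs_for[where I = I and k = n, OF s order.refl]])
      fix d R1 m1 assume I: "I d (R1, m1)" and d: "d < n"
      note h = I[unfolded I_def prod.case]
      have "Suc d * n \<le> n * n" using d by (intro mult_le_mono1) simp
      then have "n + d * n \<le> W" "Suc d \<le> W" using W_square address_bounds d by simp_all
      then show "runs W (add X X One ;; add Sq Sq N) 2 (I (Suc d)) (R1, m1)"
        by (intro runs_wp_le) (simp_all add: I_def h add.commute)
    qed (auto simp: I_def)
  qed
qed

text \<open>Ranks of unacceptable agents are never written. They are right because the memory behind
  the finished rows is still 0, which is therefore carried along as part of the claim.\<close>

lemma fill_row_correct:
  assumes "pre_env R" "filled d m" "R X = d" "R Row = row d" "R Ptr = pos d" "d < n"
    "\<forall>a>row d + n. m a = 0"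
  shows "runs W fill_row (7 + (n * (5 + 1) + 1 + 1)) (\<lambda>(R', m'). pre_env R' \<and> filled (Suc d) m' \<and>
    R' X = Suc d \<and> R' Row = row (Suc d) \<and> R' Ptr = pos (Suc d) \<and> (\<forall>a>row (Suc d) + n. m' a = 0)) (R, m)"
proof -
  define x where "x = Suc d"
  have x: "x \<in> {1..n}" using assms(6) by (simp add: x_def)
  have rowx: "row x = row d + n" by (simp add: x_def row_def)
  have rB_row: "rB + n \<le> row x" by (simp add: x_def row_def)
  note h = assms(1)[unfolded pre_env_def] assms(3-5)
  define I where "I j = (\<lambda>(R', m'). pre_env R' \<and> filled d m' \<and>
    R' X = x \<and> R' Row = row x \<and> R' Ptr = pos d \<and> R' J = pos d + j \<and> R' E = pos d + length (L x) \<and>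
    m' (rB + x) = row x \<and> (\<forall>a>row x + n. m' a = 0) \<and>
    (\<forall>y\<in>{1..n}. m' (row x + y) = (if rk x y \<le> j then rk x y else 0)))" for j
  let ?pre = "add X X One ;; add Row Row N ;; add T Rb X ;; store T Row ;;
      load U Ptr ;; add E Ptr U ;; copy J Ptr"
  let ?loop = "Loop (LessReg J E) (add J J One ;; load Y J ;; add T Row Y ;; sub U J Ptr ;; store T U)"
  have len: "length (L x) \<le> n" using length_L[OF x] by simp
  have le: "Suc d \<le> W" "row d + n \<le> W" "Suc (rB + d) \<le> W" "pos d + length (L x) \<le> W"
    "Suc (pos d + length (L x)) \<le> W" "row x + n \<le> W"
    using row_bound[OF x] rowx pos_lt_qB[OF assms(6)] address_bounds assms(6) by (simp_all add: x_def)
  show ?thesis unfolding fill_row_def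
  proof (rule runs_Seq_le[OF _ runs_Seq_le[OF _ _ order.refl] order.refl])
    have pos: "m (pos d) = length (L x)" "pos d \<noteq> Suc (rB + d)"
      using assms(2,6) pos_lt_qB[OF assms(6)] by (auto simp: filled_def lists_stored_def x_def rB_def dB_def)
    define m' where "m' = m(rB + x := row x)"
    have "filled d m'" unfolding m'_def
      using assms(2,6) by (intro filled_update) (auto simp: x_def rB_def dB_def)
    moreover have "\<forall>a>row x + n. m' a = 0" "\<forall>y\<in>{1..n}. m' (row x + y) = 0" "m' (rB + x) = row x"
      using assms(6,7) rowx rB_row by (auto simp: m'_def x_def)
    moreover have "m' (pos d) = length (L x)" using pos by (simp add: m'_def x_def)
    moreover have "pos d + length (L x) \<le> W" "x \<le> W" "rB + x \<le> W" "row x \<le> W"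
      using le by (simp_all add: x_def)
    moreover have "Suc d = x" "row d + n = row x" by (simp_all add: x_def row_def)
    ultimately show "runs W ?pre 7 (I 0) (R, m)"
      by (intro runs_wp_le) (simp_all add: I_def h pre_env_def m'_def[symmetric])
  next
    fix s assume s: "I 0 s"
    have "length (L x) * (5 + 1) + 1 \<le> n * (5 + 1) + 1" using len by simp
    then show "runs W ?loop (n * (5 + 1) + 1) (I (length (L x))) s"
    proof (rule runs_for[where I = I and k = "length (L x)", OF s])
      fix j R1 m1 assume I: "I j (R1, m1)" and j: "j < length (L x)"
      have k: "R1 One = 1" "R1 Zero = 0" "R1 N = n" "R1 G = \<gamma>" "R1 Sq = n * n"
        "R1 Qb = qB" "R1 Db = dB" "R1 Rb = rB" "R1 Ans = 0" "filled d m1"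
        "R1 X = x" "R1 Row = row x" "R1 Ptr = pos d" "R1 J = pos d + j" "R1 E = pos d + length (L x)"
        "m1 (rB + x) = row x" "\<forall>a>row x + n. m1 a = 0"
        "\<forall>y\<in>{1..n}. m1 (row x + y) = (if rk x y \<le> j then rk x y else 0)"
        using I unfolding I_def pre_env_def prod.case by blast+
      define y where "y = L x ! j"
      have y: "y \<in> {1..n}" "rk x y = Suc j" using L_nth[OF x j] rk_nth[OF x j] by (auto simp: y_def)
      have my: "m1 (Suc (pos d + j)) = y"
        using k(10) assms(6) j by (simp add: filled_def lists_stored_def x_def y_def)
      let ?m = "m1(row x + y := Suc j)"
      have "filled d ?m" using k(10) assms(6) y(1) rB_row rowx
        by (intro filled_update) (auto simp: rB_def dB_def)
      moreover have "?m (rB + x) = row x" using k(16) rB_row x y(1) by auto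
      moreover have "\<forall>a>row x + n. ?m a = 0" using k(17) y(1) by auto
      moreover have "\<forall>z\<in>{1..n}. ?m (row x + z) = (if rk x z \<le> Suc j then rk x z else 0)"
      proof
        fix z assume z: "z \<in> {1..n}"
        show "?m (row x + z) = (if rk x z \<le> Suc j then rk x z else 0)"
        proof (cases "z = y")
          case False
          \<comment> \<open>Agents with the same positive rank are the same list entry.\<close>
          then have "rk x z \<noteq> Suc j" using rk_pos(4)[OF x, of z] by (auto simp: y_def)
          then show ?thesis using False bspec[OF k(18) z] by auto
        qed (simp add: y)
      qed
      moreover have "Suc (pos d + j) \<le> W" "row x + y \<le> W" using le j y(1) by simp_all
      ultimately show "runs W (add J J One ;; load Y J ;; add T Row Y ;; sub U J Ptr ;; store T U) 5
        (I (Suc j)) (R1, m1)"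
        by (intro runs_wp_le) (simp_all add: I_def k my pre_env_def)
    qed (auto simp: I_def)
  next
    fix s assume I: "I (length (L x)) s"
    obtain R1 m1 where s: "s = (R1, m1)" by (cases s)
    have k: "R1 One = 1" "R1 Zero = 0" "R1 N = n" "R1 G = \<gamma>" "R1 Sq = n * n"
      "R1 Qb = qB" "R1 Db = dB" "R1 Rb = rB" "R1 Ans = 0" "filled d m1"
      "R1 X = x" "R1 Row = row x" "R1 Ptr = pos d" "R1 E = pos d + length (L x)"
      "m1 (rB + x) = row x" "\<forall>a>row x + n. m1 a = 0"
      "\<forall>y\<in>{1..n}. m1 (row x + y) = (if rk x y \<le> length (L x) then rk x y else 0)"
      using I unfolding I_def pre_env_def prod.case s by blast+
    have "\<forall>y\<in>{1..n}. m1 (row x + y) = rk x y"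
      using k(17) rk_pos(3)[OF x] by (metis le0)
    moreover have "{1..x} = insert x {1..d}" by (auto simp: x_def)
    ultimately have "filled x m1" using k(10,15) by (simp add: filled_def)
    moreover have "pos x = Suc (pos d + length (L x))" by (simp add: x_def pos_Suc)
    ultimately show "runs W (add Ptr E One) 1 (\<lambda>(R', m'). pre_env R' \<and> filled (Suc d) m' \<and>
      R' X = Suc d \<and> R' Row = row (Suc d) \<and> R' Ptr = pos (Suc d) \<and> (\<forall>a>row (Suc d) + n. m' a = 0)) s"
      unfolding x_def[symmetric] s using k(16) le
      by (intro runs_wp_le) (simp_all add: k pre_env_def)
  qed
qed

section \<open>Answer and total time of the whole program\<close>

lemma solver_correct:
  assumes "m 0 = n" "m 1 = \<gamma>" "lists_stored m" "\<forall>a>qB. m a = 0"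
  shows "runs W solver (110 * (2 ^ \<gamma> * (n * n)))
    (\<lambda>(R', m'). R' Ans = (if \<exists>q. good \<gamma> q then 1 else 0)) ((\<lambda>_. 0), m)"
proof -
  define I where "I d = (\<lambda>(R', m'). pre_env R' \<and> filled d m' \<and>
    R' X = d \<and> R' Row = row d \<and> R' Ptr = pos d \<and> (\<forall>a>row d + n. m' a = 0))" for d
  \<comment> \<open>\<open>v\<close> is the value of the bit vector. It is never held in a register,
    so \<open>2 ^ nbits\<close> need not fit into a word. After the last attempt the vector has
    wrapped around, hence the guard on the last conjunct.\<close>
  define K where "K v = (\<lambda>(R', m'). env R' \<and> tables m' \<and>
    R' Ans = (if \<exists>u<v. good \<gamma> (fst (guess (bit u) n)) then 1 else 0) \<and>
    R' Carry = of_bool (v = 2 ^ nbits) \<and>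
    (v < 2 ^ nbits \<longrightarrow> (\<forall>k. m' (Suc (kB + k)) = of_bool (bit v k))))" for v :: nat
  have 2: "runs W layout 6 (I 0) s"
    if "case s of (R', m') \<Rightarrow> m' = m \<and> R' One = 1 \<and> R' Zero = 0 \<and>
      R' N = n \<and> R' G = \<gamma> \<and> R' Sq = n * n \<and> R' Ans = 0" for s
  proof -
    obtain R1 m1 where s: "s = (R1, m1)" by (cases s)
    note h = that[unfolded s prod.case]
    have eqs: "Suc (n * n) = qB" "qB + n = dB" "dB + n = rB"
      by (simp_all add: qB_def dB_def rB_def)
    have "filled 0 m" using assms(3) by (simp add: filled_def)
    moreover have "\<forall>a>rB + n. m a = 0" using assms(4) by (simp add: rB_def dB_def)
    moreover have "qB \<le> W" "dB \<le> W" "rB \<le> W"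
      using address_bounds by (simp_all add: dB_def rB_def)
    moreover note address_bounds(1)
    ultimately show ?thesis unfolding s layout_def
      by (intro runs_wp_le)
        (simp_all add: h I_def pre_env_def row_def pos_0 eqs)
  qed
  have 3: "runs W (Loop (LessReg X N) fill_row) (n * (7 + (n * (5 + 1) + 1 + 1) + 1) + 1) (I n) s"
    if "I 0 s" for s
  proof (rule runs_for[where I = I and k = n, OF that order.refl])
    fix d R1 m1 assume "I d (R1, m1)" "d < n"
    then show "runs W fill_row (7 + (n * (5 + 1) + 1 + 1)) (I (Suc d)) (R1, m1)"
      unfolding I_def prod.case by (intro fill_row_correct) blast+
  qed (auto simp: I_def pre_env_def)
  have 4: "runs W bound_bits 4 (K 0) s" if "I n s" for s
  proof -
    obtain R1 m1 where s: "s = (R1, m1)" by (cases s)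
    note h = that[unfolded s I_def pre_env_def prod.case]
    have "tables m1" using h unfolding tables_def ranks_stored_def filled_def by blast
    moreover have "m1 (Suc (kB + k)) = 0" for k using h by (simp add: kB_def)
    ultimately show ?thesis unfolding s bound_bits_def using layout_bound address_bounds
      by (intro runs_wp_le) (auto simp: h K_def env_def kB_def[symmetric] eB_def min_def not_less)
  qed
  have 5: "runs W (Loop (EqReg Carry Zero) attempt) (2 ^ nbits * (80 * (n * n) + 1) + 1) (K (2 ^ nbits)) s"
    if "K 0 s" for s
  proof (rule runs_for[where I = K and k = "2 ^ nbits", OF that order.refl])
    fix v R1 m1 assume K: "K v (R1, m1)" and v: "v < 2 ^ nbits"
    have "env R1" "tables m1" "\<And>k. m1 (Suc (kB + k)) = of_bool (bit v k)"
      and ans: "R1 Ans = (if \<exists>u<v. good \<gamma> (fst (guess (bit u) n)) then 1 else 0)"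
      using K v unfolding K_def prod.case by blast+
    note A = attempt_correct[OF this(1,2) v this(3)]
    show "runs W attempt (80 * (n * n)) (K (Suc v)) (R1, m1)"
      by (rule runs_mono[OF A order.refl]) (use ans in \<open>auto simp: K_def less_Suc_eq\<close>)
  qed (auto simp: K_def env_def)
  have "runs W solver (3 + (n * (2 + 1) + 1) + (6 + (n * (7 + (n * (5 + 1) + 1 + 1) + 1) + 1 +
    (4 + (2 ^ nbits * (80 * (n * n) + 1) + 1))))) (K (2 ^ nbits)) ((\<lambda>_. 0), m)"
    unfolding solver_def
    by (rule runs_Seq_le[OF square_correct[OF assms(1,2)] _ order.refl],
      rule runs_Seq_le[OF 2 _ order.refl], assumption, rule runs_Seq_le[OF 3 _ order.refl], assumption,
      rule runs_Seq_le[OF 4 5 order.refl])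
  then show ?thesis
  proof (rule runs_mono)
    have "(2::nat) ^ nbits \<le> 2 ^ \<gamma>" by (simp add: nbits_def)
    moreover have "n * n \<ge> 1" using n_le_square(2) by linarith
    ultimately have "2 ^ nbits * (n * n) \<le> 2 ^ \<gamma> * (n * n)" "2 ^ nbits \<le> 2 ^ \<gamma> * (n * n)"
      "n * n \<le> 2 ^ \<gamma> * (n * n)"
      by (auto intro: le_trans[of _ "2 ^ \<gamma>"])
    moreover have "3 + (n * (2 + 1) + 1) + (6 + (n * (7 + (n * (5 + 1) + 1 + 1) + 1) + 1 +
      (4 + (2 ^ nbits * (80 * (n * n) + 1) + 1)))) =
      16 + 13 * n + 6 * (n * n) + 80 * (2 ^ nbits * (n * n)) + 2 ^ nbits"
      by (simp add: algebra_simps)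
    \<comment> \<open>By \<open>2 * n \<le> n * n\<close> and \<open>4 \<le> n * n\<close> the left
      side is below 98 times \<open>2 ^ \<gamma> * (n * n)\<close>; 110 leaves some slack.\<close>
    ultimately show "3 + (n * (2 + 1) + 1) + (6 + (n * (7 + (n * (5 + 1) + 1 + 1) + 1) + 1 +
      (4 + (2 ^ nbits * (80 * (n * n) + 1) + 1)))) \<le> 110 * (2 ^ \<gamma> * (n * n))"
      using n_le_square by linarith
  next
    fix s assume "K (2 ^ nbits) s"
    \<comment> \<open>Completeness of guessing enters only here; the other direction is immediate,
      since each attempt tests \<open>good\<close> itself.\<close>
    moreover have "(\<exists>q. good \<gamma> q) \<longleftrightarrow> (\<exists>u::nat. u < 2 ^ nbits \<and> good \<gamma> (fst (guess (bit u) n)))"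
      unfolding nbits_def using exists_guess by blast
    ultimately show "case s of (R', m') \<Rightarrow> R' Ans = (if \<exists>q. good \<gamma> q then 1 else 0)"
      by (auto simp: K_def)
  qed
qed

end

section \<open>Matchings as functions\<close>

lemma profileD:
  assumes "profile n V P" "i \<in> {1..n}"
  shows "V i \<subseteq> {1..n} - {i}" "P i \<subseteq> V i \<times> V i" "strict_linear_order_on (V i) (P i)" "finite (V i)"
proof -
  show V: "V i \<subseteq> {1..n} - {i}" and "P i \<subseteq> V i \<times> V i" "strict_linear_order_on (V i) (P i)"
    using assms by (auto simp: profile_def agents_def)
  show "finite (V i)" by (rule finite_subset[OF V]) simp
qed

lemma rank_less_iff:
  assumes "profile n V P" "i \<in> {1..n}" "x \<in> V i" "y \<in> V i"
  shows "(x, y) \<in> P i \<longleftrightarrow> rank P i x < rank P i y"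
proof -
  note p = profileD[OF assms(1,2)]
  from p(3) have tr: "trans (P i)" and ir: "irrefl (P i)" and tot: "total_on (V i) (P i)"
    by (auto simp: strict_linear_order_on_def)
  have fin: "finite {x. (x, y) \<in> P i}" for y
    by (rule finite_subset[OF _ p(4)]) (use p(2) in auto)
  have less: "rank P i x < rank P i y" if "(x, y) \<in> P i" for x y
    unfolding rank_def
    by (rule psubset_card_mono[OF fin]) (use that tr ir in \<open>auto simp: irrefl_def dest: transD\<close>)
  show ?thesis
    using less[of x y] less[of y x] tot assms(3,4) unfolding total_on_def by (metis less_asym less_irrefl)
qed

lemma length_preference_list: "length (preference_list V P i) = card (V i)"
  by (simp add: preference_list_def)

lemma preference_list_props:
  assumes "profile n V P" "i \<in> {1..n}"
  shows "set (preference_list V P i) = V i" "distinct (preference_list V P i)"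
proof -
  note p = profileD[OF assms]
  have bij: "bij_betw (rank P i) (V i) {..<card (V i)}" using bij_betw_rank[of V i P] p by blast
  have nth: "preference_list V P i ! rank P i x = x" "rank P i x < card (V i)" if "x \<in> V i" for x
    using nth_preference_list_rank[OF assms(1), of i x] assms(2) that
    by (simp_all add: agents_def length_preference_list)
  show set: "set (preference_list V P i) = V i"
  proof
    show "V i \<subseteq> set (preference_list V P i)"
      using nth by (metis length_preference_list nth_mem subsetI)
    show "set (preference_list V P i) \<subseteq> V i"
    proof
      fix y assume "y \<in> set (preference_list V P i)"
      then obtain k where k: "k < card (V i)" "preference_list V P i ! k = y"
        by (auto simp: in_set_conv_nth length_preference_list)
      then have "k \<in> rank P i ` V i" using bij by (simp add: bij_betw_def)
      then obtain x where "x \<in> V i" "rank P i x = k" by blast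
      then show "y \<in> V i" using nth(1) k(2) by metis
    qed
  qed
  then show "distinct (preference_list V P i)"
    by (simp add: card_distinct length_preference_list)
qed

lemma roommates_preference_list:
  assumes "profile n V P" "2 \<le> n"
  shows "roommates n (preference_list V P)"
  using assms preference_list_props[OF assms(1)] profileD(1)[OF assms(1)] by unfold_locales auto

lemma mem_edges_iff:
  "{x, y} \<in> acceptability_edges n V \<longleftrightarrow> x \<in> {1..n} \<and> y \<in> {1..n} \<and> x \<in> V y \<and> y \<in> V x"
  by (auto simp: acceptability_edges_def agents_def doubleton_eq_iff)

lemma partner_eq_Some:
  assumes "matching n V M"
  shows "partner M x = Some y \<longleftrightarrow> {x, y} \<in> M"
proof -
  have uniq: "y = z" if "{x, y} \<in> M" "{x, z} \<in> M" for y z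
  proof -
    have "{x, y} = {x, z}"
      using assms that unfolding matching_def by (metis disjointD disjoint_iff insertI1)
    then show ?thesis by (auto simp: doubleton_eq_iff)
  qed
  then have "(THE z. {x, z} \<in> M) = y" if "{x, y} \<in> M" for y using that by blast
  then show ?thesis by (auto simp: partner_def)
qed

context
  fixes n :: nat and V :: "nat \<Rightarrow> nat set" and P :: "nat \<Rightarrow> nat rel"
  assumes profile: "profile n V P" and n2: "2 \<le> n"
begin

interpretation roommates n "preference_list V P"
  by (rule roommates_preference_list[OF profile n2])

lemma rk_rank:
  assumes "i \<in> {1..n}"
  shows "rk i y = (if y \<in> V i then Suc (rank P i y) else 0)"
  using rk_eq_0[of i y] rk_nth[OF assms, of "rank P i y"] preference_list_props(1)[OF profile assms]
    nth_preference_list_rank[OF profile, of i y] assms by (auto simp: agents_def)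

text \<open>Shared by both directions of the equivalence below, which differ in whether
  \<open>M\<close> or \<open>q\<close> is given and the other one constructed.\<close>

lemma matching_function:
  assumes M: "matching n V M"
    and q: "\<And>x. x \<in> {1..n} \<Longrightarrow> partner M x = (if q x = 0 then None else Some (q x))"
    and valid: "\<And>x. x \<in> {1..n} \<Longrightarrow> valid_at q x"
  shows "stable_matching n V P M \<and> egalitarian_cost n V P M \<le> \<gamma> \<longleftrightarrow> good \<gamma> q"
proof -
  have dis: "rank_option V P x (partner M x) = dis q x" if x: "x \<in> {1..n}" for x
    using valid[OF x] q[OF x] rk_rank[OF x, of "q x"]
    by (auto simp: rank_option_def dis_def valid_at_def length_preference_list split: if_splits)
  have cost: "egalitarian_cost n V P M = sum (dis q) {1..n}"
    unfolding egalitarian_cost_def agents_def by (rule sum.cong[OF refl dis])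
  have prefers: "prefers_to_partner P M x y \<longleftrightarrow> rk x y \<le> dis q x"
    if x: "x \<in> {1..n}" and y: "y \<in> V x" for x y
  proof (cases "q x = 0")
    case True
    have "rk x y \<le> length (preference_list V P x)" using rk_pos(3)[OF x, of y] by (cases "rk x y = 0") auto
    then show ?thesis using True q[OF x] by (simp add: prefers_to_partner_def dis_def)
  next
    case False
    then have "q x \<in> V x" using valid[OF x] rk_rank[OF x, of "q x"] by (auto simp: valid_at_def split: if_splits)
    then show ?thesis using False q[OF x] rk_rank[OF x] y rank_less_iff[OF profile x y]
      by (auto simp: prefers_to_partner_def dis_def)
  qed
  have "blocks n V P x y M \<longleftrightarrow> x \<in> {1..n} \<and> y \<in> {1..n} \<and> blocking q x y" for x y
  proof (cases "x \<in> {1..n} \<and> y \<in> {1..n} \<and> x \<in> V y \<and> y \<in> V x")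
    case False
    then show ?thesis using rk_rank[of x y] rk_rank[of y x] unfolding blocks_def blocking_def mem_edges_iff by auto
  next
    case True
    \<comment> \<open>A partner has \<open>rk x y = Suc (dis q x)\<close>, so
      \<open>blocking\<close> implies that the pair lies outside \<open>M\<close>.\<close>
    then have "rk x y \<le> dis q x \<Longrightarrow> {x, y} \<notin> M"
      using q[of x] rk_rank[of x y] partner_eq_Some[OF M, of x y] by (auto simp: dis_def split: if_splits)
    then show ?thesis
      using True prefers[of x y] prefers[of y x] rk_rank[of x y] rk_rank[of y x]
      unfolding blocks_def blocking_def mem_edges_iff by auto
  qed
  then show ?thesis using M valid by (auto simp: stable_matching_def good_def cost)
qed

lemma egalitarian_stable_roommates_iff:
  "egalitarian_stable_roommates n V P \<gamma> \<longleftrightarrow> (\<exists>q. good \<gamma> q)"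
proof
  assume "egalitarian_stable_roommates n V P \<gamma>"
  then obtain M where M: "stable_matching n V P M \<and> egalitarian_cost n V P M \<le> \<gamma>"
    by (auto simp: egalitarian_stable_roommates_def)
  then have match: "matching n V M" by (simp add: stable_matching_def)
  have edge: "x \<in> {1..n} \<and> y \<in> {1..n} \<and> x \<in> V y \<and> y \<in> V x" if "{x, y} \<in> M" for x y
    using that match mem_edges_iff unfolding matching_def by blast
  \<comment> \<open>Agents are numbered from 1, so 0 is free to stand for being unmatched.\<close>
  define q where "q x = (case partner M x of None \<Rightarrow> 0 | Some y \<Rightarrow> y)" for x
  have q: "partner M x = (if q x = 0 then None else Some (q x))" for x
    using edge[of x] partner_eq_Some[OF match, of x] by (cases "partner M x") (auto simp: q_def)
  have "valid_at q x" if "x \<in> {1..n}" for x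
    unfolding valid_at_def
  proof (intro impI)
    assume "q x \<noteq> 0"
    then have xy: "{x, q x} \<in> M" using q[of x] partner_eq_Some[OF match, of x] by simp
    then have "partner M (q x) = Some x" using partner_eq_Some[OF match] by (simp add: insert_commute)
    then show "q (q x) = x \<and> rk x (q x) \<noteq> 0" using rk_rank[OF that] edge[OF xy] by (simp add: q_def)
  qed
  then have "good \<gamma> q" using matching_function[OF match q] M by blast
  then show "\<exists>q. good \<gamma> q" by blast
next
  assume "\<exists>q. good \<gamma> q"
  then obtain q where q: "good \<gamma> q" by blast
  define M where "M = {{x, q x} | x. x \<in> {1..n} \<and> q x \<noteq> 0}"
  have valid: "valid_at q x" if "x \<in> {1..n}" for x using q that by (simp add: good_def)
  have inv: "q x \<in> {1..n}" "q (q x) = x" "q x \<in> V x" if "x \<in> {1..n}" "q x \<noteq> 0" for x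
    using valid[OF that(1)] that(2) rk_rank[OF that(1)] rk_pos(1)[OF that(1), of "q x"]
    by (auto simp: valid_at_def split: if_splits)
  have M_iff: "{x, y} \<in> M \<longleftrightarrow> x \<in> {1..n} \<and> q x \<noteq> 0 \<and> y = q x" for x y
  proof
    assume "{x, y} \<in> M"
    then obtain z where z: "z \<in> {1..n}" "q z \<noteq> 0" "{x, y} = {z, q z}" by (auto simp: M_def)
    then show "x \<in> {1..n} \<and> q x \<noteq> 0 \<and> y = q x"
      using inv[OF z(1,2)] by (auto simp: doubleton_eq_iff)
  qed (auto simp: M_def)
  have match: "matching n V M"
    unfolding matching_def
  proof
    show "M \<subseteq> acceptability_edges n V"
    proof
      fix e assume "e \<in> M"
      then obtain x where x: "x \<in> {1..n}" "q x \<noteq> 0" "e = {x, q x}" by (auto simp: M_def)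
      have "x \<in> V (q x)" using inv[OF x(1,2)] inv(3)[of "q x"] x(1) by auto
      then show "e \<in> acceptability_edges n V" using inv[OF x(1,2)] x by (simp add: mem_edges_iff)
    qed
    show "disjoint M"
    proof (rule disjointI)
      fix a b assume ab: "a \<in> M" "b \<in> M" "a \<noteq> b"
      show "a \<inter> b = {}"
      proof (rule ccontr)
        assume "a \<inter> b \<noteq> {}"
        then obtain z where z: "z \<in> a" "z \<in> b" by blast
        \<comment> \<open>\<open>q\<close> is an involution on the matched agents, so an edge is
          determined by either endpoint; this gives disjointness.\<close>
        have "e = {z, q z}" if e: "e \<in> M" "z \<in> e" for e
        proof -
          from e(1) obtain x where x: "x \<in> {1..n}" "q x \<noteq> 0" "e = {x, q x}" by (auto simp: M_def)
          then show ?thesis using e(2) inv[OF x(1,2)] by auto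
        qed
        then show False using z ab by blast
      qed
    qed
  qed
  have "partner M x = (if q x = 0 then None else Some (q x))" if "x \<in> {1..n}" for x
    using that partner_eq_Some[OF match, of x] M_iff[of x] by (cases "partner M x") auto
  then have "stable_matching n V P M \<and> egalitarian_cost n V P M \<le> \<gamma>"
    using matching_function[OF match _ valid] q by blast
  then show "egalitarian_stable_roommates n V P \<gamma>"
    by (auto simp: egalitarian_stable_roommates_def)
qed

end

section \<open>The encoding of instances\<close>

lemma (in roommates_ram) length_lists:
  assumes "\<And>i. length (f i) = Suc (length (L i))"
  shows "length (concat (map f [1..<Suc i])) + 2 = pos i"
  by (induction i) (simp_all add: assms pos_0 pos_Suc)

lemma (in roommates_ram) nth_lists:
  assumes "\<And>i. length (f i) = Suc (length (L i))" "i < n" "j \<le> length (L (Suc i))"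
  shows "(a # b # concat (map f [1..<Suc n])) ! (pos i + j) = f (Suc i) ! j"
proof -
  have "[1..<Suc n] = [1..<Suc i] @ Suc i # [Suc (Suc i)..<Suc n]"
    using assms(2) upt_add_eq_append[of 1 "Suc i" "n - i"] upt_conv_Cons[of "Suc i" "Suc n"] by simp
  then have "a # b # concat (map f [1..<Suc n]) =
      (a # b # concat (map f [1..<Suc i])) @ (f (Suc i) @ concat (map f [Suc (Suc i)..<Suc n]))"
    by (simp del: upt_Suc)
  moreover have "length (a # b # concat (map f [1..<Suc i])) = pos i"
    using length_lists[OF assms(1), of i] by (simp del: upt_Suc)
  ultimately have "(a # b # concat (map f [1..<Suc n])) ! (pos i + j) =
      (f (Suc i) @ concat (map f [Suc (Suc i)..<Suc n])) ! j"
    by (metis nth_append_length_plus)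
  then show ?thesis using assms(1)[of "Suc i"] assms(3) by (simp add: nth_append del: upt_Suc)
qed

theorem theorem7:
  shows "\<exists>(p :: program) (c :: nat) (k :: nat).
    \<forall>(n :: nat) (V :: nat \<Rightarrow> nat set) (P :: nat \<Rightarrow> nat rel) (\<gamma> :: nat).
      even n \<and> n > 0 \<and> profile n V P \<longrightarrow>
        decides_within p ((n + \<gamma>) ^ k) (encode_instance n V P \<gamma>)
          (egalitarian_stable_roommates n V P \<gamma>) (c * (2 ^ \<gamma> * n ^ 2))"
proof (rule exI[of _ solver], rule exI[of _ 110], rule exI[of _ 6], intro allI impI)
  fix n \<gamma> :: nat and V P
  assume asm: "even n \<and> n > 0 \<and> profile n V P"
  \<comment> \<open>With \<open>n = 1\<close> and \<open>\<gamma> = 0\<close> the word bound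
    \<open>(n + \<gamma>) ^ k\<close> would be 1 for every \<open>k\<close>, too small for the
    layout.\<close>
  then have n2: "2 \<le> n" and profile: "profile n V P" by auto
  define W where "W = (n + \<gamma>) ^ 6"
  \<comment> \<open>The origin of the exponent 6: \<open>n ^ 4\<close> pays for the factor 16, and
    \<open>n ^ 2\<close> for the size of the memory.\<close>
  have "2 ^ 4 * n ^ 2 \<le> n ^ 4 * n ^ 2" by (intro mult_right_mono power_mono) (use n2 in auto)
  also have "\<dots> = n ^ 6" by (simp flip: power_add)
  also have "\<dots> \<le> W" unfolding W_def by (intro power_mono) auto
  finally have W_square: "16 * (n * n) \<le> W" by (simp add: power2_eq_square)
  have W_sum: "n + \<gamma> \<le> W" unfolding W_def using n2 by (intro self_le_power) auto
  interpret roommates n "preference_list V P"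
    by (rule roommates_preference_list[OF profile n2])
  interpret roommates_ram n "preference_list V P" \<gamma> W
    by unfold_locales (use W_square W_sum in auto)
  define f where "f i = card (V i) # preference_list V P i" for i
  define xs where "xs = encode_instance n V P \<gamma>"
  define m where "m = snd (initial_state xs)"
  have xs: "xs = n # \<gamma> # concat (map f [1..<Suc n])"
    by (simp add: xs_def encode_instance_def f_def[abs_def])
  have f: "length (f i) = Suc (length (preference_list V P i))" for i by (simp add: f_def)
  have len: "length xs = pos n" using length_lists[OF f, of n] by (simp add: xs)
  have m: "m a = (if a < length xs then xs ! a else 0)" for a by (simp add: m_def initial_state_def)
  have init: "initial_state xs = ((\<lambda>_. 0), m)" by (simp add: m_def initial_state_def)
  have "set xs \<subseteq> {..W}"
  proof -
    have "set (f i) \<subseteq> {..W}" if "i \<in> {1..n}" for i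
      using length_L[OF that] preference_list_props(1)[OF profile that] profileD(1)[OF profile that] W_sum
      by (fastforce simp: f_def length_preference_list)
    moreover have "set (concat (map f [1..<Suc n])) = (\<Union>i\<in>{1..n}. set (f i))"
      by (simp add: atLeastLessThanSuc_atLeastAtMost del: upt_Suc)
    ultimately have "set (concat (map f [1..<Suc n])) \<subseteq> {..W}"
      by (simp only: UN_least)
    then show ?thesis using W_sum by (simp add: xs del: upt_Suc)
  qed
  then have "m a \<le> W" for a using subsetD[OF _ nth_mem, of xs "{..W}" a] by (auto simp: m)
  then have fits: "fits W (initial_state xs)" by (simp add: fits_def init)
  have "lists_stored m"
  proof -
    have "m (pos i + j) = f (Suc i) ! j" if i: "i < n" and j: "j \<le> length (preference_list V P (Suc i))" for i j
    proof -
      have "pos i + j < pos (Suc i)" using j by (simp add: pos_Suc)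
      also have "\<dots> \<le> pos n" unfolding pos_def using i by (intro add_left_mono sum_mono2) auto
      finally have "pos i + j < length xs" unfolding len .
      then show ?thesis using nth_lists[OF f i j, of n \<gamma>] unfolding m xs[symmetric] by simp
    qed
    from this[of _ 0] this[of _ "Suc _"] show ?thesis
      by (auto simp: lists_stored_def f_def length_preference_list)
  qed
  \<comment> \<open>The input has \<open>pos n\<close> cells, at most \<open>n * n + 2\<close>, so
    its last address is at most \<open>qB\<close>.\<close>
  moreover have "\<forall>a>qB. m a = 0" using pos_le[of n] by (simp add: m len qB_def)
  moreover have "m 0 = n" "m 1 = \<gamma>" by (simp_all add: m xs)
  ultimately have "runs W solver (110 * (2 ^ \<gamma> * (n * n)))
    (\<lambda>(R', m'). R' Ans = (if \<exists>q. good \<gamma> q then 1 else 0)) (initial_state xs)"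
    unfolding init by (intro solver_correct)
  then obtain t s' where "exec W solver (initial_state xs) t s'" "t \<le> 110 * (2 ^ \<gamma> * n ^ 2)"
    "fst s' 0 = (if \<exists>q. good \<gamma> q then 1 else 0)"
    using fits by (auto simp: runs_def power2_eq_square)
  then show "decides_within solver ((n + \<gamma>) ^ 6) (encode_instance n V P \<gamma>)
    (egalitarian_stable_roommates n V P \<gamma>) (110 * (2 ^ \<gamma> * n ^ 2))"
    unfolding decides_within_def egalitarian_stable_roommates_iff[OF profile n2] W_def[symmetric] xs_def[symmetric]
    by blast
qed

end
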